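(* Let $G$ be a maximal outerplanar graph of order $n\ge 4$. Then either $G$ is a generalized sun graph, or $G$ admits two disjoint total dominating sets.
   Context: All graphs are finite and simple; the order of a graph is its number of vertices. A set $S\subseteq V(G)$ is a total dominating set of $G$ if every vertex of $G$ (including those in $S$) is adjacent to at least one vertex of $S$. A maximal outerplanar graph is an outerplanar graph to which no edge can be added (on the same vertex set) without destroying outerplanarity. For order $n\ge 3$, in its outerplanar embedding the boundary of the unbounded face is a Hamiltonian cycle (the Hamiltonian cycle of the graph), and all bounded faces are triangles. Central vertex: a vertex $v$ of a maximal outerplanar graph $G$ of order $n$ is called central if (i) no vertex of degree $2$ lies in the closed neighborhood $\{v\}\cup N(v)$, and (ii) when the vertices are indexed consecutively along the Hamiltonian cycle as $v=v_0,v_1,\dots,v_{n-1}$, the indices of all neighbors of $v$ are pairwise congruent modulo $4$. Generalized sun graph: a maximal outerplanar graph of order $n=4k+2$ with $k\ge 1$ (so $n\equiv 2\pmod 4$) in which the number of degree $2$ vertices plus the number of central vertices equals $n/2$. *)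

theory Defs
  imports "HOL-Analysis.Analysis"
begin

text \<open>A finite simple graph is given by its vertex set and its set of two-element edges.\<close>

definition simple_graph :: "'a set \<Rightarrow> 'a set set \<Rightarrow> bool" where
  "simple_graph V E \<longleftrightarrow> finite V \<and> (\<forall>e\<in>E. e \<subseteq> V \<and> card e = 2)"

definition neighbors :: "'a set set \<Rightarrow> 'a \<Rightarrow> 'a set" where
  "neighbors E v = {u. {v, u} \<in> E}"

definition vertex_degree :: "'a set set \<Rightarrow> 'a \<Rightarrow> nat" where
  "vertex_degree E v = card (neighbors E v)"

definition total_dominating :: "'a set \<Rightarrow> 'a set set \<Rightarrow> 'a set \<Rightarrow> bool" where
  "total_dominating V E S \<longleftrightarrow> S \<subseteq> V \<and> (\<forall>v\<in>V. \<exists>u\<in>S. {v, u} \<in> E)"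

text \<open>
  Vertex \<open>v\<close> is drawn at the point \<open>p v\<close> and edge \<open>e\<close> as the arc \<open>g e\<close>, in either direction.
  An arc meets the vertex points only in its endpoints, and two arcs meet only in
  common endpoints.
\<close>

definition plane_drawing ::
    "'a set \<Rightarrow> 'a set set \<Rightarrow> ('a \<Rightarrow> complex) \<Rightarrow> ('a set \<Rightarrow> real \<Rightarrow> complex) \<Rightarrow> bool" where
  "plane_drawing V E p g \<longleftrightarrow>
     inj_on p V \<and>
     (\<forall>e\<in>E. arc (g e) \<and> {pathstart (g e), pathfinish (g e)} = p ` e \<and>
             path_image (g e) \<inter> p ` V \<subseteq> p ` e) \<and>
     (\<forall>e\<in>E. \<forall>f\<in>E. e \<noteq> f \<longrightarrow> path_image (g e) \<inter> path_image (g f) \<subseteq> p ` (e \<inter> f))"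

definition drawn_set ::
    "'a set \<Rightarrow> 'a set set \<Rightarrow> ('a \<Rightarrow> complex) \<Rightarrow> ('a set \<Rightarrow> real \<Rightarrow> complex) \<Rightarrow> complex set" where
  "drawn_set V E p g = p ` V \<union> (\<Union>e\<in>E. path_image (g e))"

text \<open>
  The drawn set of a finite graph is compact, so its \<^const>\<open>outside\<close> is the unique unbounded
  face of the drawing, and the frontier of that set is the boundary of the unbounded face.
\<close>

definition outerplanar :: "'a set \<Rightarrow> 'a set set \<Rightarrow> bool" where
  "outerplanar V E \<longleftrightarrow>
     (\<exists>p g. plane_drawing V E p g \<and> p ` V \<subseteq> frontier (outside (drawn_set V E p g)))"

definition maximal_outerplanar :: "'a set \<Rightarrow> 'a set set \<Rightarrow> bool" where
  "maximal_outerplanar V E \<longleftrightarrow>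
     simple_graph V E \<and> outerplanar V E \<and>
     (\<forall>u\<in>V. \<forall>v\<in>V. u \<noteq> v \<and> {u, v} \<notin> E \<longrightarrow> \<not> outerplanar V (insert {u, v} E))"

definition hamiltonian_cycle :: "'a set \<Rightarrow> 'a set set \<Rightarrow> 'a list \<Rightarrow> bool" where
  "hamiltonian_cycle V E c \<longleftrightarrow>
     distinct c \<and> set c = V \<and> length c \<ge> 3 \<and>
     (\<forall>i<length c. {c ! i, c ! (Suc i mod length c)} \<in> E)"

text \<open>
  The Hamiltonian cycle of a maximal outerplanar graph of order at least 3 is unique and is the
  boundary of the unbounded face. Only the direction of the indexing from \<open>v\<close> is free, and
  reversal sends index \<open>i\<close> to \<open>n - i\<close>, which preserves pairwise congruence, so the choice of \<open>c\<close>
  does not matter.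
\<close>

definition central :: "'a set \<Rightarrow> 'a set set \<Rightarrow> 'a \<Rightarrow> bool" where
  "central V E v \<longleftrightarrow>
     v \<in> V \<and>
     (\<forall>u \<in> insert v (neighbors E v). vertex_degree E u \<noteq> 2) \<and>
     (\<exists>c. hamiltonian_cycle V E c \<and> c ! 0 = v \<and>
        (\<forall>i<length c. \<forall>j<length c.
           c ! i \<in> neighbors E v \<and> c ! j \<in> neighbors E v \<longrightarrow> i mod 4 = j mod 4))"

definition generalized_sun :: "'a set \<Rightarrow> 'a set set \<Rightarrow> bool" where
  "generalized_sun V E \<longleftrightarrow>
     maximal_outerplanar V E \<and>
     (\<exists>k\<ge>1. card V = 4 * k + 2) \<and>
     card {v \<in> V. vertex_degree E v = 2} + card {v \<in> V. central V E v} = card V div 2"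

definition two_disjoint_total_dominating_sets :: "'a set \<Rightarrow> 'a set set \<Rightarrow> bool" where
  "two_disjoint_total_dominating_sets V E \<longleftrightarrow>
     (\<exists>S T. total_dominating V E S \<and> total_dominating V E T \<and> S \<inter> T = {})"

end

theory Submission imports Defs
begin

text \<open>
Two disjoint total dominating sets are the same thing as a colouring of the vertices with two
colours in which every vertex has neighbours of both colours. The proof first replaces the drawn
graph by a triangulated polygon and then decides when such a colouring exists.

\<^bold>\<open>From drawings to polygons.\<close> A graph drawn with all vertices on the outer face
contains neither three internally disjoint paths with common ends and interior vertices on all three
nor a cycle with two crossing chords. Both facts rest on theta curves: of three arcs with common
ends, one lies inside the closed curve formed by the other two (\<open>theta_arc_inside\<close>,
from Janiszewski's theorem), whereas no vertex lies inside a closed curve of the drawing. Graphs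
without these two configurations have a vertex order in which no two edges cross
(\<open>noncrossing_order_exists\<close>): split the graph at a cut vertex while possible; in a
graph that cannot be split, a longest cycle passes through all vertices. Conversely, a noncrossing
order gives an outerplanar drawing with straight chords of a parabola
(\<open>noncrossing_order_imp_outerplanar\<close>). So a maximal outerplanar graph of order
\<open>n\<close> is a maximal noncrossing set of edges on \<open>0, ..., n - 1\<close>, that is, a
triangulated polygon.

\<^bold>\<open>Colourings.\<close> Colour every second vertex alternately along the polygon. If
\<open>4\<close> divides \<open>n\<close>, the two sides of each vertex get different colours. If
\<open>n\<close> is odd, this fails at one vertex only, which may be chosen freely; a suitable
choice has a third neighbour that repairs it. If \<open>n\<close> is \<open>2\<close> modulo
\<open>4\<close>, even and odd positions form two odd cycles, so at least one vertex of each parity has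
to be repaired. Call a vertex rigid if all its neighbours are at distance \<open>1\<close> modulo
\<open>4\<close>. A rigid vertex cannot be repaired in this way. If some vertex of each parity is not
rigid, then either some edge has length \<open>3\<close> modulo \<open>4\<close> and both of its ends
can be repaired, or two adjacent triangles have opposite majority parities and provide the repair
(\<open>colouring_mod_2\<close>). If one parity class is rigid throughout, then no colouring exists: a
two-coloured edge between vertices of the other class, whose length is divisible by
\<open>4\<close>, encloses a shorter one (\<open>no_bichromatic_edge\<close>).

\<^bold>\<open>Counting.\<close> Adjacent vertices are never both rigid, so at most \<open>n / 2\<close>
vertices are rigid, with equality exactly if they form a parity class. Since the Hamiltonian cycle is
unique, the rigid vertices are exactly the vertices of degree \<open>2\<close> and the central ones, and
the condition becomes that of a generalized sun graph.
\<close>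

section \<open>Walks as vertex lists\<close>

fun walk_edges :: "'a list \<Rightarrow> 'a set set" where
  "walk_edges (x # y # zs) = insert {x, y} (walk_edges (y # zs))"
| "walk_edges _ = {}"

lemma walk_edges_subset: "e \<in> walk_edges xs \<Longrightarrow> e \<subseteq> set xs"
  by (induction xs rule: walk_edges.induct) auto

lemma walk_edges_append: "walk_edges (xs @ y # ys) = walk_edges (xs @ [y]) \<union> walk_edges (y # ys)"
  by (induction xs rule: walk_edges.induct) (cases ys; auto)+

lemma walk_edges_Cons: "xs \<noteq> [] \<Longrightarrow> walk_edges (x # xs) = insert {x, hd xs} (walk_edges xs)"
  by (cases xs) auto

lemma walk_edges_rev: "walk_edges (rev xs) = walk_edges xs"
proof (induction xs rule: walk_edges.induct)
  case (1 x y zs)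
  have "walk_edges (rev (x # y # zs)) = walk_edges (rev zs @ y # [x])" by simp
  also have "\<dots> = walk_edges (rev (y # zs)) \<union> {{y, x}}" by (subst walk_edges_append) simp
  finally show ?case using 1 by (auto simp: insert_commute)
qed auto

text \<open>
The length bound matters: a one-vertex list has no edges, so its vertex would be lost from any image
that is built from edges alone.
\<close>

lemma vertex_in_walk_edge: "x \<in> set xs \<Longrightarrow> 2 \<le> length xs \<Longrightarrow> \<exists>e\<in>walk_edges xs. x \<in> e"
proof (induction xs rule: walk_edges.induct)
  case (1 x y zs) then show ?case by (cases zs) auto
qed auto

text \<open>
This makes internally disjoint walks edge-disjoint: an edge of one of them touches an interior vertex
that the other walk avoids. A single edge between the ends has no such vertex.
\<close>

lemma walk_edge_meets_interior:
  assumes "e \<in> walk_edges (c # A @ [d])" "card e = 2" "A \<noteq> []"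
  shows "e \<inter> set A \<noteq> {}"
proof -
  have "walk_edges (c # A @ [d]) = insert {c, hd A} (walk_edges (A @ [d]))"
    using assms(3) walk_edges_Cons[of "A @ [d]" c] by simp
  then consider "e = {c, hd A}" | "e \<in> walk_edges (A @ [d])" using assms(1) by blast
  then show ?thesis
  proof cases
    case 1 then show ?thesis using assms(3) by auto
  next
    case 2
    show ?thesis
    proof
      assume "e \<inter> set A = {}"
      then have "e \<subseteq> {d}" using walk_edges_subset[OF 2] by auto
      then have "card e \<le> 1" using card_mono[of "{d}" e] by simp
      then show False using assms(2) by simp
    qed
  qed
qed

section \<open>Theta curves in the plane\<close>

lemma closed_curve_of_arcs:
  assumes "arc g1" "arc g2" "pathstart g1 = a" "pathfinish g1 = b" "pathstart g2 = a" "pathfinish g2 = b"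
    and "path_image g1 \<inter> path_image g2 = {a, b}"
  shows "simple_path (g1 +++ reversepath g2)" "pathfinish (g1 +++ reversepath g2) = pathstart (g1 +++ reversepath g2)"
    "path_image (g1 +++ reversepath g2) = path_image g1 \<union> path_image g2"
proof -
  show "simple_path (g1 +++ reversepath g2)"
    using assms by (intro simple_path_join_loop) (auto simp: arc_reversepath)
qed (use assms in \<open>auto simp: path_image_join\<close>)

text \<open>
The Jordan curve theorem, phrased for the union of two arcs so that theta curves can be treated
symmetrically in their three arcs.
\<close>

lemma two_arcs_inside_outside:
  fixes g1 g2 :: "real \<Rightarrow> complex"
  assumes "arc g1" "arc g2" "pathstart g1 = a" "pathfinish g1 = b" "pathstart g2 = a" "pathfinish g2 = b"
    and "path_image g1 \<inter> path_image g2 = {a, b}"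
  defines "C \<equiv> path_image g1 \<union> path_image g2"
  shows "inside C \<noteq> {}" "open (inside C)" "connected (inside C)" "open (outside C)" "connected (outside C)"
    "frontier (inside C) = C"
  using Jordan_inside_outside[OF closed_curve_of_arcs(1,2)[OF assms(1-7)]]
  unfolding closed_curve_of_arcs(3)[OF assms(1-7)] C_def by blast+

text \<open>
An arc without its ends is connected and misses the closed curve.
\<close>

lemma open_arc_inside_or_outside:
  fixes g1 g2 g3 :: "real \<Rightarrow> complex"
  assumes "arc g1" "arc g2" "arc g3"
    and "pathstart g1 = a" "pathfinish g1 = b" "pathstart g2 = a" "pathfinish g2 = b" "pathstart g3 = a" "pathfinish g3 = b"
    and "path_image g1 \<inter> path_image g2 = {a, b}" "path_image g1 \<inter> path_image g3 = {a, b}" "path_image g2 \<inter> path_image g3 = {a, b}"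
  defines "C \<equiv> path_image g1 \<union> path_image g2"
  shows "path_image g3 - {a, b} \<subseteq> inside C \<or> path_image g3 - {a, b} \<subseteq> outside C"
proof -
  have con: "connected (path_image g3 - {a, b})"
    using connected_simple_path_endless[OF arc_imp_simple_path[OF assms(3)]] assms by simp
  have "path_image g3 - {a, b} \<subseteq> inside C \<union> outside C"
    using assms(10-12) by (auto simp: C_def)
  then show ?thesis
    using connectedD[OF con two_arcs_inside_outside(2)[OF assms(1,2,4-7,10)] two_arcs_inside_outside(4)[OF assms(1,2,4-7,10)]]
      inside_Int_outside[of C] unfolding C_def by blast
qed

text \<open>
Suppose that the third arc runs outside the curve \<open>C\<close> of the first two, and take a
point \<open>x\<close> inside \<open>C\<close> and a point \<open>y\<close> far away. The curves
through the third arc meet in that arc only, which is connected; so if neither of them separated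
\<open>x\<close> from \<open>y\<close>, then by Janiszewski's theorem their union would not either,
although it contains \<open>C\<close>. Hence one of these curves has \<open>x\<close>, and with it the
whole region inside \<open>C\<close>, in its interior. The remaining arc is on the boundary of that
region and does not meet the curve except in its ends.
\<close>

lemma theta_arc_inside:
  fixes g1 g2 g3 :: "real \<Rightarrow> complex"
  assumes "arc g1" "arc g2" "arc g3"
    and "pathstart g1 = a" "pathfinish g1 = b" "pathstart g2 = a" "pathfinish g2 = b" "pathstart g3 = a" "pathfinish g3 = b"
    and "path_image g1 \<inter> path_image g2 = {a, b}" "path_image g1 \<inter> path_image g3 = {a, b}" "path_image g2 \<inter> path_image g3 = {a, b}"
  shows "path_image g1 - {a, b} \<subseteq> inside (path_image g2 \<union> path_image g3) \<or>
    path_image g2 - {a, b} \<subseteq> inside (path_image g1 \<union> path_image g3) \<or>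
    path_image g3 - {a, b} \<subseteq> inside (path_image g1 \<union> path_image g2)"
proof (rule disjCI)
  let ?I1 = "path_image g1" and ?I2 = "path_image g2" and ?I3 = "path_image g3"
  let ?R = "inside (?I1 \<union> ?I2)"
  assume neg: "\<not> (?I2 - {a, b} \<subseteq> inside (?I1 \<union> ?I3) \<or> ?I3 - {a, b} \<subseteq> ?R)"
  then have out3: "?I3 - {a, b} \<subseteq> outside (?I1 \<union> ?I2)"
    using open_arc_inside_or_outside[OF assms] by blast
  have comp: "compact ?I1" "compact ?I2" "compact ?I3"
    using assms(1-3) by (auto intro: compact_arc_image)
  note J12 = two_arcs_inside_outside[OF assms(1,2,4-7,10)]
  obtain x where x: "x \<in> ?R" using J12(1) by blast
  have x3: "x \<notin> ?I1 \<union> ?I2 \<union> ?I3"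
    using x out3 inside_Int_outside[of "?I1 \<union> ?I2"] inside_no_overlap[of "?I1 \<union> ?I2"] assms(11,12) by blast
  have bdd: "bounded (?I1 \<union> ?I2 \<union> ?I3)" using comp by (simp add: compact_imp_bounded)
  obtain y where y: "y \<in> outside (?I1 \<union> ?I2 \<union> ?I3)"
    using outside_bounded_nonempty[OF bdd] by blast
  have sep: "connected_component (- (?I1 \<union> ?I3)) x y \<Longrightarrow> connected_component (- (?I2 \<union> ?I3)) x y \<Longrightarrow> False"
  proof -
    assume c: "connected_component (- (?I1 \<union> ?I3)) x y" "connected_component (- (?I2 \<union> ?I3)) x y"
    have "(?I1 \<union> ?I3) \<inter> (?I2 \<union> ?I3) = ?I3" using assms(10-12) by auto
    then have "connected ((?I1 \<union> ?I3) \<inter> (?I2 \<union> ?I3))" using assms(3) by (simp add: connected_arc_image)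
    from Janiszewski[OF _ _ this c] comp
    have "connected_component (- (?I1 \<union> ?I3 \<union> (?I2 \<union> ?I3))) x y"
      by (simp add: compact_Un compact_imp_closed closed_Un)
    then have "connected_component (- (?I1 \<union> ?I2)) x y"
      by (rule connected_component_of_subset) auto
    moreover have "y \<in> outside (?I1 \<union> ?I2)" using y outside_mono[of "?I1 \<union> ?I2" "?I1 \<union> ?I2 \<union> ?I3"] by auto
    ultimately have "x \<in> outside (?I1 \<union> ?I2)"
      using outside_same_component connected_component_sym by metis
    then show False using x inside_Int_outside by blast
  qed
  \<comment> \<open>Here J and K are the first two arcs in either order.\<close>
  have main: "J - {a, b} \<subseteq> inside (K \<union> ?I3)"
    if ins: "x \<in> inside (K \<union> ?I3)" and JK: "J \<union> K = ?I1 \<union> ?I2" "J \<inter> K = {a, b}" "J \<inter> ?I3 = {a, b}" 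
    and fr: "frontier (inside (K \<union> ?I3)) = K \<union> ?I3" for J K
  proof -
    have "?R \<inter> (K \<union> ?I3) = {}"
    proof -
      have "?R \<inter> ?I3 = {}" 
        using out3 inside_Int_outside[of "?I1 \<union> ?I2"] inside_no_overlap[of "?I1 \<union> ?I2"] assms(11,12) by blast
      moreover have "?R \<inter> K = {}" using inside_no_overlap[of "?I1 \<union> ?I2"] JK by blast
      ultimately show ?thesis by blast
    qed
    then have "?R \<subseteq> inside (K \<union> ?I3)"
      using inside_same_component x ins J12(3) 
      by (metis connected_component_def disjoint_eq_subset_Compl order_refl subsetI)
    then have "closure ?R \<subseteq> inside (K \<union> ?I3) \<union> (K \<union> ?I3)"
      using fr closure_mono[of ?R "inside (K \<union> ?I3)"] closure_Un_frontier by metis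
    moreover have "J \<subseteq> closure ?R" using J12(6) JK frontier_def by blast
    ultimately show ?thesis using JK by blast
  qed
  have "\<not> ?I2 - {a, b} \<subseteq> inside (?I1 \<union> ?I3)" using neg by blast
  then have "x \<notin> inside (?I1 \<union> ?I3)"
    using main[of ?I1 ?I2] assms(10-12) two_arcs_inside_outside(6)[OF assms(1,3,4,5,8,9,11)] by blast
  then have "x \<in> outside (?I1 \<union> ?I3)" using x3 inside_Un_outside by blast
  moreover have "y \<in> outside (?I1 \<union> ?I3)" using y outside_mono[of "?I1 \<union> ?I3" "?I1 \<union> ?I2 \<union> ?I3"] by auto
  moreover have "connected_component (- C) x y" if "x \<in> outside C" "y \<in> outside C" "connected (outside C)" for C :: "complex set"
    using that outside_no_overlap unfolding connected_component_def by (metis disjoint_eq_subset_Compl inf_commute)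
  ultimately have "connected_component (- (?I1 \<union> ?I3)) x y"
    using two_arcs_inside_outside(5)[OF assms(1,3,4,5,8,9,11)] by blast
  then have nc: "\<not> connected_component (- (?I2 \<union> ?I3)) x y" using sep by blast
  have "x \<in> inside (?I2 \<union> ?I3)"
  proof (rule ccontr)
    assume "x \<notin> inside (?I2 \<union> ?I3)"
    then have "x \<in> outside (?I2 \<union> ?I3)" using x3 inside_Un_outside by blast
    moreover have "y \<in> outside (?I2 \<union> ?I3)" using y outside_mono[of "?I2 \<union> ?I3" "?I1 \<union> ?I2 \<union> ?I3"] by auto
    ultimately show False
      using nc two_arcs_inside_outside(5)[OF assms(2,3,6,7,8,9,12)] outside_no_overlap
      unfolding connected_component_def by (metis disjoint_eq_subset_Compl inf_commute)
  qed
  then show "?I1 - {a, b} \<subseteq> inside (?I2 \<union> ?I3)"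
    using main[of ?I2 ?I1] assms(10-12) two_arcs_inside_outside(6)[OF assms(2,3,6,7,8,9,12)] by blast
qed

section \<open>Drawings with all vertices on the outer face\<close>

locale outer_drawing =
  fixes V :: "'a set" and E :: "'a set set" and p :: "'a \<Rightarrow> complex" and g :: "'a set \<Rightarrow> real \<Rightarrow> complex"
  assumes graph: "simple_graph V E"
    and drawing: "plane_drawing V E p g"
    and outer: "p ` V \<subseteq> frontier (outside (drawn_set V E p g))"
begin

definition walk_image :: "'a list \<Rightarrow> complex set" where
  "walk_image xs = (\<Union>e\<in>walk_edges xs. path_image (g e))"

lemma edge: "e \<in> E \<Longrightarrow> e \<subseteq> V \<and> card e = 2"
  using graph unfolding simple_graph_def by blast

lemma walk_vertices: "walk_edges xs \<subseteq> E \<Longrightarrow> 2 \<le> length xs \<Longrightarrow> set xs \<subseteq> V"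
  using vertex_in_walk_edge[of _ xs] edge by (meson subset_iff)

lemma inj_p: "u \<in> V \<Longrightarrow> v \<in> V \<Longrightarrow> p u = p v \<Longrightarrow> u = v"
  using drawing unfolding plane_drawing_def inj_on_def by blast

lemma edge_arc:
  assumes "{x, y} \<in> E"
  obtains h where "arc h" "pathstart h = p x" "pathfinish h = p y" "path_image h = path_image (g {x, y})"
proof -
  have "arc (g {x, y})" "{pathstart (g {x, y}), pathfinish (g {x, y})} = {p x, p y}"
    using drawing assms unfolding plane_drawing_def by auto
  then consider "arc (g {x, y})" "pathstart (g {x, y}) = p x" "pathfinish (g {x, y}) = p y"
    | "arc (g {x, y})" "pathstart (g {x, y}) = p y" "pathfinish (g {x, y}) = p x"
    by (auto simp: doubleton_eq_iff)
  then show ?thesis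
  proof cases
    case 1 then show ?thesis using that by blast
  next
    case 2 then show ?thesis using that[of "reversepath (g {x, y})"] by (simp add: arc_reversepath)
  qed
qed

lemma vertex_on_edge: "e \<in> E \<Longrightarrow> x \<in> e \<Longrightarrow> p x \<in> path_image (g e)"
proof -
  assume "e \<in> E" "x \<in> e"
  then have "p x \<in> {pathstart (g e), pathfinish (g e)}" using drawing unfolding plane_drawing_def by blast
  then show ?thesis by auto
qed

lemma vertex_on_walk_image_iff:
  assumes "walk_edges xs \<subseteq> E" "2 \<le> length xs" "v \<in> V"
  shows "p v \<in> walk_image xs \<longleftrightarrow> v \<in> set xs"
proof
  assume "p v \<in> walk_image xs"
  then obtain e where e: "e \<in> walk_edges xs" "p v \<in> path_image (g e)" unfolding walk_image_def by blast
  then have "p v \<in> p ` e" using drawing assms unfolding plane_drawing_def by blast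
  then have "v \<in> e" using inj_p assms(3) edge e(1) assms(1) by blast
  then show "v \<in> set xs" using walk_edges_subset e(1) by blast
next
  assume "v \<in> set xs"
  then show "p v \<in> walk_image xs"
    using vertex_in_walk_edge[OF _ assms(2)] vertex_on_edge assms(1) unfolding walk_image_def by blast
qed

lemma walk_images_Int:
  assumes "walk_edges xs \<subseteq> E" "walk_edges ys \<subseteq> E" "walk_edges xs \<inter> walk_edges ys = {}"
  shows "walk_image xs \<inter> walk_image ys \<subseteq> p ` (set xs \<inter> set ys)"
proof
  fix z assume "z \<in> walk_image xs \<inter> walk_image ys"
  then obtain e f where ef: "e \<in> walk_edges xs" "f \<in> walk_edges ys" "z \<in> path_image (g e)" "z \<in> path_image (g f)"
    unfolding walk_image_def by blast
  then have "e \<in> E" "f \<in> E" "e \<noteq> f" using assms by auto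
  then have "z \<in> p ` (e \<inter> f)" using drawing ef(3,4) unfolding plane_drawing_def by blast
  then show "z \<in> p ` (set xs \<inter> set ys)" using walk_edges_subset ef(1,2) by blast
qed

text \<open>
Graph walks become topological arcs: consecutive edges meet only in the drawn common vertex.
\<close>

lemma walk_arc:
  assumes "distinct xs" "2 \<le> length xs" "walk_edges xs \<subseteq> E"
  obtains h where "arc h" "pathstart h = p (hd xs)" "pathfinish h = p (last xs)" "path_image h = walk_image xs"
proof -
  have "\<exists>h. arc h \<and> pathstart h = p (hd xs) \<and> pathfinish h = p (last xs) \<and> path_image h = walk_image xs"
    using assms
  proof (induction xs rule: walk_edges.induct)
    case (1 x y zs)
    obtain h1 where h1: "arc h1" "pathstart h1 = p x" "pathfinish h1 = p y" "path_image h1 = path_image (g {x, y})"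
      using edge_arc[of x y] 1(4) by auto
    show ?case
    proof (cases "zs = []")
      case True
      then show ?thesis using h1 by (auto simp: walk_image_def)
    next
      case False
      then obtain h2 where h2: "arc h2" "pathstart h2 = p y" "pathfinish h2 = p (last zs)"
          "path_image h2 = walk_image (y # zs)"
        using 1 by (cases zs) auto
      have "walk_edges [x, y] \<inter> walk_edges (y # zs) = {}"
        using walk_edges_subset[of _ "y # zs"] 1(2) by auto
      from walk_images_Int[OF _ _ this] 
      have "walk_image [x, y] \<inter> walk_image (y # zs) \<subseteq> p ` (set [x, y] \<inter> set (y # zs))" using 1(4) by simp
      also have "\<dots> \<subseteq> {p y}" using 1(2) by auto
      finally have "path_image h1 \<inter> path_image h2 \<subseteq> {pathstart h2}"
        using h1 h2 by (simp add: walk_image_def)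
      then have "arc (h1 +++ h2)" using arc_join h1 h2 by metis
      then show ?thesis using h1 h2 False
        by (intro exI[of _ "h1 +++ h2"]) (auto simp: path_image_join walk_image_def)
    qed
  qed auto
  then show ?thesis using that by blast
qed

lemma walk_image_subset_drawn: "walk_edges xs \<subseteq> E \<Longrightarrow> walk_image xs \<subseteq> drawn_set V E p g"
  unfolding walk_image_def drawn_set_def by blast

text \<open>
The interior of a closed curve of the drawing is open and disjoint from the outer face, while every
vertex is a limit of points of the outer face.
\<close>

lemma vertex_not_inside:
  assumes "v \<in> V" "K \<subseteq> drawn_set V E p g" "open (inside K)"
  shows "p v \<notin> inside K"
proof
  assume "p v \<in> inside K"
  moreover have "p v \<in> closure (outside (drawn_set V E p g))"
    using outer assms(1) unfolding frontier_def by blast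
  ultimately obtain z where "z \<in> inside K" "z \<in> outside (drawn_set V E p g)"
    using assms(3) by (metis disjoint_iff open_Int_closure_eq_empty)
  then show False using outside_mono[OF assms(2)] inside_Int_outside by blast
qed

text \<open>
One of the two walks may be the single edge between the ends, which is how chords are treated as
walks later; both at once would share that edge.
\<close>

lemma walks_disjoint_edges:
  assumes "distinct (c # d # A @ B)" "walk_edges (c # A @ [d]) \<subseteq> E" "walk_edges (c # B @ [d]) \<subseteq> E" "A \<noteq> [] \<or> B \<noteq> []"
  shows "walk_edges (c # A @ [d]) \<inter> walk_edges (c # B @ [d]) = {}"
proof -
  have *: "walk_edges (c # A @ [d]) \<inter> walk_edges (c # B @ [d]) = {}"
    if "distinct (c # d # A @ B)" "walk_edges (c # A @ [d]) \<subseteq> E" "A \<noteq> []" for A B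
  proof (rule ccontr)
    assume "\<not> ?thesis"
    then obtain e where e: "e \<in> walk_edges (c # A @ [d])" "e \<in> walk_edges (c # B @ [d])" by blast
    then have "card e = 2" using edge that(2) by blast
    then have "e \<inter> set A \<noteq> {}" using walk_edge_meets_interior[OF e(1) _ that(3)] by simp
    moreover have "e \<subseteq> set (c # B @ [d])" using walk_edges_subset[OF e(2)] .
    moreover have "set A \<inter> set (c # B @ [d]) = {}" using that(1) by auto
    ultimately show False by blast
  qed
  show ?thesis
  proof (cases "A = []")
    case True
    then show ?thesis using *[of B A] assms by auto
  next
    case False
    then show ?thesis using *[of A B] assms by auto
  qed
qed

lemma walks_meet_in_ends:
  assumes "distinct (c # d # A @ B)" "walk_edges (c # A @ [d]) \<subseteq> E" "walk_edges (c # B @ [d]) \<subseteq> E" "A \<noteq> [] \<or> B \<noteq> []"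
  shows "walk_image (c # A @ [d]) \<inter> walk_image (c # B @ [d]) = {p c, p d}"
proof
  have "set (c # A @ [d]) \<inter> set (c # B @ [d]) = {c, d}" using assms(1) by auto
  then show "walk_image (c # A @ [d]) \<inter> walk_image (c # B @ [d]) \<subseteq> {p c, p d}"
    using walk_images_Int[OF assms(2,3) walks_disjoint_edges[OF assms]] by auto
  have "c \<in> V" "d \<in> V" using walk_vertices[OF assms(2)] by auto
  then show "{p c, p d} \<subseteq> walk_image (c # A @ [d]) \<inter> walk_image (c # B @ [d])"
    using vertex_on_walk_image_iff[OF assms(2)] vertex_on_walk_image_iff[OF assms(3)] by auto
qed

lemma closed_walk_image_open_inside:
  assumes "distinct (c # d # A @ B)" "walk_edges (c # A @ [d]) \<subseteq> E" "walk_edges (c # B @ [d]) \<subseteq> E" "A \<noteq> [] \<or> B \<noteq> []"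
  defines "K \<equiv> walk_image (c # A @ [d]) \<union> walk_image (c # B @ [d])"
  shows "open (inside K)" "frontier (inside K) = K" "v \<in> V \<Longrightarrow> p v \<notin> inside K"
proof -
  obtain h1 where h1: "arc h1" "pathstart h1 = p c" "pathfinish h1 = p d" "path_image h1 = walk_image (c # A @ [d])"
    using walk_arc[of "c # A @ [d]"] assms by auto
  obtain h2 where h2: "arc h2" "pathstart h2 = p c" "pathfinish h2 = p d" "path_image h2 = walk_image (c # B @ [d])"
    using walk_arc[of "c # B @ [d]"] assms by auto
  show *: "open (inside K)" "frontier (inside K) = K"
    using two_arcs_inside_outside[OF h1(1) h2(1) h1(2,3) h2(2,3)] walks_meet_in_ends[OF assms(1-4)]
    unfolding h1 h2 K_def by blast+
  show "p v \<notin> inside K" if "v \<in> V"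
    using vertex_not_inside[OF that _ *(1)] walk_image_subset_drawn assms unfolding K_def by blast
qed

text \<open>
In the theta curve of the three walks, the first two carry a vertex in their interior and so cannot be
the arc that lies inside the other two.
\<close>

lemma third_walk_inside:
  assumes "distinct (c # d # A @ B @ C)" "A \<noteq> []" "B \<noteq> []"
    and "walk_edges (c # A @ [d]) \<subseteq> E" "walk_edges (c # B @ [d]) \<subseteq> E" "walk_edges (c # C @ [d]) \<subseteq> E"
  shows "walk_image (c # C @ [d]) - {p c, p d} \<subseteq> inside (walk_image (c # A @ [d]) \<union> walk_image (c # B @ [d]))"
proof -
  have dist: "distinct (c # d # A @ B)" "distinct (c # d # A @ C)" "distinct (c # d # B @ C)" using assms(1) by auto
  obtain h1 where h1: "arc h1" "pathstart h1 = p c" "pathfinish h1 = p d" "path_image h1 = walk_image (c # A @ [d])"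
    using walk_arc[of "c # A @ [d]"] assms by auto
  obtain h2 where h2: "arc h2" "pathstart h2 = p c" "pathfinish h2 = p d" "path_image h2 = walk_image (c # B @ [d])"
    using walk_arc[of "c # B @ [d]"] assms by auto
  obtain h3 where h3: "arc h3" "pathstart h3 = p c" "pathfinish h3 = p d" "path_image h3 = walk_image (c # C @ [d])"
    using walk_arc[of "c # C @ [d]"] assms by auto
  have theta: "walk_image (c # A @ [d]) - {p c, p d} \<subseteq> inside (walk_image (c # B @ [d]) \<union> walk_image (c # C @ [d])) \<or>
    walk_image (c # B @ [d]) - {p c, p d} \<subseteq> inside (walk_image (c # A @ [d]) \<union> walk_image (c # C @ [d])) \<or>
    walk_image (c # C @ [d]) - {p c, p d} \<subseteq> inside (walk_image (c # A @ [d]) \<union> walk_image (c # B @ [d]))"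
    using theta_arc_inside[OF h1(1) h2(1) h3(1) h1(2,3) h2(2,3) h3(2,3)]
      walks_meet_in_ends[OF dist(1)] walks_meet_in_ends[OF dist(2)] walks_meet_in_ends[OF dist(3)] assms
    unfolding h1 h2 h3 by blast
  have vertex: "p v \<in> walk_image (c # X @ [d]) - {p c, p d} \<and> v \<in> V"
    if "v \<in> set X" "walk_edges (c # X @ [d]) \<subseteq> E" "distinct (c # d # X)" for v X
  proof -
    have V: "v \<in> V" "c \<in> V" "d \<in> V" using walk_vertices[OF that(2)] that(1) by auto
    then have "p v \<noteq> p c" "p v \<noteq> p d" using inj_p that by auto
    then show ?thesis using vertex_on_walk_image_iff[OF that(2) _ V(1)] that(1) V by auto
  qed
  have "\<not> walk_image (c # A @ [d]) - {p c, p d} \<subseteq> inside (walk_image (c # B @ [d]) \<union> walk_image (c # C @ [d]))"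
    using vertex[of "hd A" A] closed_walk_image_open_inside(3)[OF dist(3)] assms by auto
  moreover have "\<not> walk_image (c # B @ [d]) - {p c, p d} \<subseteq> inside (walk_image (c # A @ [d]) \<union> walk_image (c # C @ [d]))"
    using vertex[of "hd B" B] closed_walk_image_open_inside(3)[OF dist(2)] assms by auto
  ultimately show ?thesis using theta by blast
qed

text \<open>
This excludes subdivisions of the complete bipartite graph with parts of size \<open>2\<close> and
\<open>3\<close>.
\<close>

lemma no_theta:
  assumes "distinct (c # d # A @ B @ C)" "A \<noteq> []" "B \<noteq> []" "C \<noteq> []"
    and "walk_edges (c # A @ [d]) \<subseteq> E" "walk_edges (c # B @ [d]) \<subseteq> E" "walk_edges (c # C @ [d]) \<subseteq> E"
  shows False
proof -
  have dist: "distinct (c # d # A @ B)" using assms(1) by auto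
  let ?v = "hd C"
  have V: "?v \<in> V" "c \<in> V" "d \<in> V" using walk_vertices[OF assms(7)] assms(4) by auto
  then have "p ?v \<noteq> p c" "p ?v \<noteq> p d" using inj_p assms(1,4) by (auto, (metis hd_in_set)+)
  moreover have "p ?v \<in> walk_image (c # C @ [d])"
    using vertex_on_walk_image_iff[OF assms(7) _ V(1)] assms(4) by auto
  ultimately show False
    using third_walk_inside[OF assms(1-3,5-7)] closed_walk_image_open_inside(3)[OF dist assms(5,6) _ V(1)] assms(2) by blast
qed

text \<open>
Both chords run inside the cycle. The chord from \<open>c\<close> to \<open>d\<close> cuts the inside
of the cycle into two regions, one at each of the two paths, and the other chord stays in one of
them. But then its end on the opposite path would lie in the closure of that region.
\<close>

lemma no_crossing_chords:
  assumes dist: "distinct (c # d # A @ B)"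
    and walks: "walk_edges (c # A @ [d]) \<subseteq> E" "walk_edges (c # B @ [d]) \<subseteq> E"
    and cd: "{c, d} \<in> E" and ab: "{a, b} \<in> E" "a \<in> set A" "b \<in> set B"
  shows False
proof -
  let ?IA = "walk_image (c # A @ [d])" and ?IB = "walk_image (c # B @ [d])" and ?D = "walk_image [c, d]"
    and ?D' = "walk_image [a, b]"
  have ne: "A \<noteq> []" "B \<noteq> []" using ab by auto
  have cdE: "walk_edges (c # [] @ [d]) \<subseteq> E" and abE: "walk_edges (a # [] @ [b]) \<subseteq> E" using cd ab by auto
  obtain A1 A2 where A: "A = A1 @ a # A2" using ab(2) split_list by metis
  obtain B1 B2 where B: "B = B1 @ b # B2" using ab(3) split_list by metis
  \<comment> \<open>The same cycle, cut at the ends of the other chord.\<close>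
  let ?P = "rev A1 @ c # B1" and ?Q = "A2 @ d # rev B2"
  have eA: "walk_edges (c # A @ [d]) = walk_edges (c # A1 @ [a]) \<union> walk_edges (a # A2 @ [d])"
    using walk_edges_append[of "c # A1" a "A2 @ [d]"] unfolding A by simp
  have eB: "walk_edges (c # B @ [d]) = walk_edges (c # B1 @ [b]) \<union> walk_edges (b # B2 @ [d])"
    using walk_edges_append[of "c # B1" b "B2 @ [d]"] unfolding B by simp
  have eP: "walk_edges (a # ?P @ [b]) = walk_edges (c # A1 @ [a]) \<union> walk_edges (c # B1 @ [b])"
    using walk_edges_append[of "a # rev A1" c "B1 @ [b]"] walk_edges_rev[of "c # A1 @ [a]"] by simp
  have eQ: "walk_edges (a # ?Q @ [b]) = walk_edges (a # A2 @ [d]) \<union> walk_edges (b # B2 @ [d])"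
    using walk_edges_append[of "a # A2" d "rev B2 @ [b]"] walk_edges_rev[of "b # B2 @ [d]"] by simp
  have PQ: "walk_image (a # ?P @ [b]) \<union> walk_image (a # ?Q @ [b]) = ?IA \<union> ?IB"
    unfolding walk_image_def eA eB eP eQ by blast
  have "?D' - {p a, p b} \<subseteq> inside (walk_image (a # ?P @ [b]) \<union> walk_image (a # ?Q @ [b]))"
  proof -
    have "distinct (a # b # ?P @ ?Q @ [])" using dist unfolding A B by auto
    moreover have "walk_edges (a # ?P @ [b]) \<subseteq> E" "walk_edges (a # ?Q @ [b]) \<subseteq> E"
      using walks unfolding eP eQ eA eB by auto
    ultimately show ?thesis using third_walk_inside[of a b ?P ?Q "[]"] abE by simp
  qed
  then have D': "?D' - {p a, p b} \<subseteq> inside (?IA \<union> ?IB)" unfolding PQ .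
  have D: "?D - {p c, p d} \<subseteq> inside (?IA \<union> ?IB)"
    using third_walk_inside[of c d A B "[]"] dist ne walks cdE by simp
  obtain hA where hA: "arc hA" "pathstart hA = p c" "pathfinish hA = p d" "path_image hA = ?IA"
    using walk_arc[of "c # A @ [d]"] dist walks by auto
  obtain hB where hB: "arc hB" "pathstart hB = p c" "pathfinish hB = p d" "path_image hB = ?IB"
    using walk_arc[of "c # B @ [d]"] dist walks by auto
  obtain hD where hD: "arc hD" "pathstart hD = p c" "pathfinish hD = p d" "path_image hD = ?D"
    using walk_arc[of "[c, d]"] dist cdE by auto
  obtain hD' where hD': "arc hD'" "pathstart hD' = p a" "pathfinish hD' = p b" "path_image hD' = ?D'"
  proof -
    have "a \<noteq> b" using dist ab by auto
    then show ?thesis using walk_arc[of "[a, b]"] that ab(1) by auto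
  qed
  have dA: "distinct (c # d # A @ [])" and dB: "distinct (c # d # B @ [])" using dist by auto
  have nD: "path_image hD - {p c, p d} \<noteq> {}"
    using nonempty_simple_path_endless[OF arc_imp_simple_path[OF hD(1)]] hD by simp
  have split: "inside (?IA \<union> ?D) \<inter> inside (?IB \<union> ?D) = {}"
     "inside (?IA \<union> ?D) \<union> inside (?IB \<union> ?D) \<union> (?D - {p c, p d}) = inside (?IA \<union> ?IB)"
  proof -
    have "p c \<noteq> p d" using arc_distinct_ends[OF hA(1)] hA by simp
    moreover have "path_image hA \<inter> path_image hB = {p c, p d}" "path_image hA \<inter> path_image hD = {p c, p d}"
      "path_image hB \<inter> path_image hD = {p c, p d}"
      using walks_meet_in_ends[OF dist walks] walks_meet_in_ends[OF dA walks(1) cdE]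
        walks_meet_in_ends[OF dB walks(2) cdE] ne unfolding hA hB hD by auto
    moreover have "path_image hD \<inter> inside (path_image hA \<union> path_image hB) \<noteq> {}"
      using nD D unfolding hA hB hD by blast
    ultimately show "inside (?IA \<union> ?D) \<inter> inside (?IB \<union> ?D) = {}"
     "inside (?IA \<union> ?D) \<union> inside (?IB \<union> ?D) \<union> (?D - {p c, p d}) = inside (?IA \<union> ?IB)"
      using split_inside_simple_closed_curve[OF arc_imp_simple_path[OF hA(1)] hA(2,3)
          arc_imp_simple_path[OF hB(1)] hB(2,3) arc_imp_simple_path[OF hD(1)] hD(2,3)]
      unfolding hA(4) hB(4) hD(4) by metis+
  qed
  have "walk_edges [a, b] \<inter> walk_edges [c, d] = {}" using dist ab by (auto simp: doubleton_eq_iff)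
  then have "?D' \<inter> ?D \<subseteq> p ` (set [a, b] \<inter> set [c, d])" using walk_images_Int[of "[a, b]" "[c, d]"] cd ab by simp
  also have "\<dots> = {}" using dist ab by auto
  finally have disj: "?D' \<inter> ?D = {}" by blast
  let ?O = "?D' - {p a, p b}"
  have con: "connected ?O"
    using connected_simple_path_endless[OF arc_imp_simple_path[OF hD'(1)]] unfolding hD' .
  note opA = closed_walk_image_open_inside[OF dA walks(1) cdE]
    and opB = closed_walk_image_open_inside[OF dB walks(2) cdE]
  have sub: "?O \<subseteq> inside (?IA \<union> ?D) \<union> inside (?IB \<union> ?D)" using D' split(2) disj by blast
  have "open (inside (?IA \<union> ?D))" "open (inside (?IB \<union> ?D))" using opA(1) opB(1) ne by auto
  then have side: "?O \<subseteq> inside (?IA \<union> ?D) \<or> ?O \<subseteq> inside (?IB \<union> ?D)"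
    using connectedD[OF con, of "inside (?IA \<union> ?D)" "inside (?IB \<union> ?D)"] sub split(1) by blast
  \<comment> \<open>The ends of the chord are limits of its interior points.\<close>
  have clO: "?D' \<subseteq> closure ?O"
  proof -
    have O: "?O = hD' ` {0<..<1}" using simple_path_endless[OF arc_imp_simple_path[OF hD'(1)]] unfolding hD' .
    have "continuous_on (closure {0<..<1}) hD'"
      using arc_imp_path[OF hD'(1)] unfolding path_def by (simp add: closure_greaterThanLessThan)
    then have "hD' ` closure {0<..<1} \<subseteq> closure (hD' ` {0<..<1})"
      by (rule image_closure_subset) (auto simp: closure_subset)
    moreover have "?D' = hD' ` closure {0<..<1}"
      unfolding hD'(4)[symmetric] path_image_def by (simp add: closure_greaterThanLessThan)
    ultimately show ?thesis unfolding O by simp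
  qed
  have V: "a \<in> V" "b \<in> V" using edge ab by auto
  have inD': "p a \<in> ?D'" "p b \<in> ?D'" using vertex_on_walk_image_iff[of "[a, b]"] V ab by auto
  have no: False if "?O \<subseteq> inside (walk_image (c # X @ [d]) \<union> ?D)" "v \<notin> set (c # X @ [d])" "p v \<in> ?D'" "v \<in> V"
    "X \<noteq> []" "distinct (c # d # X @ [])" "walk_edges (c # X @ [d]) \<subseteq> E" for X v
  proof -
    note opX = closed_walk_image_open_inside[OF that(6,7) cdE]
    let ?K = "walk_image (c # X @ [d]) \<union> ?D"
    have "p v \<in> closure (inside ?K)" using clO that(1,3) closure_mono by blast
    then have "p v \<in> inside ?K \<union> ?K" using opX(2) that(5) closure_Un_frontier[of "inside ?K"] by auto
    moreover have "p v \<notin> ?K"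
      using vertex_on_walk_image_iff[OF that(7) _ that(4)] vertex_on_walk_image_iff[OF cdE _ that(4)] that(2) by auto
    ultimately show False using opX(3)[OF _ that(4)] that(5) by auto
  qed
  show False
    using side
  proof
    assume "?O \<subseteq> inside (?IA \<union> ?D)"
    then show False using no[of A b] dist ab ne walks V inD' by auto
  next
    assume "?O \<subseteq> inside (?IB \<union> ?D)"
    then show False using no[of B a] dist ab ne walks V inD' by auto
  qed
qed

end

section \<open>Noncrossing vertex orders\<close>

definition noncrossing_order :: "'a set set \<Rightarrow> ('a \<Rightarrow> nat) \<Rightarrow> bool" where
  "noncrossing_order E r \<longleftrightarrow>
     (\<forall>a b c d. {a, b} \<in> E \<longrightarrow> {c, d} \<in> E \<longrightarrow> \<not> (r a < r c \<and> r c < r b \<and> r b < r d))"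

lemma noncrossing_orderD:
  "noncrossing_order E r \<Longrightarrow> {a, b} \<in> E \<Longrightarrow> {c, d} \<in> E \<Longrightarrow> r a < r c \<Longrightarrow> r c < r b \<Longrightarrow> r b < r d \<Longrightarrow> False"
  unfolding noncrossing_order_def by blast

text \<open>
Whether two chords cross depends only on the cyclic order, so the vertices before \<open>v\<close> may
be moved to the end.
\<close>

lemma rotate_noncrossing_order:
  assumes fin: "finite V" and sub: "\<And>e. e \<in> E \<Longrightarrow> e \<subseteq> V" and inj: "inj_on r V" and nc: "noncrossing_order E r"
  obtains r' where "inj_on r' V" "noncrossing_order E r'" "\<And>u. u \<in> V \<Longrightarrow> r' v \<le> r' u"
proof
  define M where "M = Suc (Max (insert (r v) (r ` V)))"
  define r' where "r' = (\<lambda>x. if r x < r v then r x + M else r x)"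
  have M: "r x < M" if "x \<in> V" for x
    unfolding M_def less_Suc_eq_le by (rule Max_ge) (use fin that in auto)
  have Mv: "r v < M" unfolding M_def less_Suc_eq_le by (rule Max_ge) (use fin in auto)
  show "inj_on r' V"
  proof (rule inj_onI)
    fix x y assume xy: "x \<in> V" "y \<in> V" "r' x = r' y"
    have "r x = r y" using xy(3) M[OF xy(1)] M[OF xy(2)] unfolding r'_def by (simp split: if_splits)
    then show "x = y" using inj xy(1,2) by (meson inj_onD)
  qed
  show "r' v \<le> r' u" if "u \<in> V" for u using Mv unfolding r'_def by auto
  show "noncrossing_order E r'"
    unfolding noncrossing_order_def
  proof (intro allI impI notI)
    fix a b c d assume e: "{a, b} \<in> E" "{c, d} \<in> E" and o: "r' a < r' c \<and> r' c < r' b \<and> r' b < r' d"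
    have V: "a \<in> V" "b \<in> V" "c \<in> V" "d \<in> V" using sub e by auto
    have e': "{b, a} \<in> E" "{d, c} \<in> E" using e by (auto simp: insert_commute)
    note n = noncrossing_orderD[OF nc]
    \<comment> \<open>L holds for the vertices that are moved to the end. The four instances of the noncrossing
      property below are the cyclic rotations of a single crossing.\<close>
    define L where "L = (\<lambda>x. r x < r v)"
    have less: "r' x < r' y \<longleftrightarrow> (if L x = L y then r x < r y else L y)" if "x \<in> V" "y \<in> V" for x y
      using M[OF that(1)] M[OF that(2)] unfolding r'_def L_def by simp
    have early: "L x \<Longrightarrow> \<not> L y \<Longrightarrow> r x < r y" for x y unfolding L_def by simp
    have o': "r' a < r' c" "r' c < r' b" "r' b < r' d" using o by simp_all
    note o'' = o'[unfolded less[OF V(1,3)] less[OF V(3,2)] less[OF V(2,4)]]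
    show False
      using n[OF e] n[OF e'(2) e(1)] n[OF e'] n[OF e(2) e'(1)] o''
        early[of b a] early[of d a] early[of c a] early[of d c] early[of d b] early[of b c]
      by (cases "L a"; cases "L c"; cases "L b"; cases "L d") simp_all
  qed
qed

text \<open>
If two parts share at most one vertex and it comes first in both orders, then the second part can be
listed after the first one. Minimality and injectivity leave room for one shared vertex only.
\<close>

lemma glue_noncrossing_orders:
  assumes fin: "finite V1"
    and edges: "\<And>e. e \<in> E \<Longrightarrow> e \<subseteq> V1 \<or> e \<subseteq> V2"
    and r1: "inj_on r1 V1" "noncrossing_order {e \<in> E. e \<subseteq> V1} r1" "\<And>v u. v \<in> V1 \<inter> V2 \<Longrightarrow> u \<in> V1 \<Longrightarrow> r1 v \<le> r1 u"
    and r2: "inj_on r2 V2" "noncrossing_order {e \<in> E. e \<subseteq> V2} r2" "\<And>v u. v \<in> V1 \<inter> V2 \<Longrightarrow> u \<in> V2 \<Longrightarrow> r2 v \<le> r2 u"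
  obtains r :: "'a \<Rightarrow> nat" where "inj_on r (V1 \<union> V2)" "noncrossing_order E r"
proof
  define M where "M = Suc (Max (insert 0 (r1 ` V1)))"
  define r where "r = (\<lambda>x. if x \<in> V1 then r1 x else r2 x + M)"
  have M: "r1 x < M" if "x \<in> V1" for x
    unfolding M_def less_Suc_eq_le by (rule Max_ge) (use fin that in auto)
  have in1: "r x < M \<longleftrightarrow> x \<in> V1" for x using M unfolding r_def by auto
  have same1: "r x < r y \<longleftrightarrow> r1 x < r1 y" if "x \<in> V1" "y \<in> V1" for x y using that unfolding r_def by simp
  \<comment> \<open>The shared vertex keeps its place in the first part, and this agrees with its being first in
    the second part.\<close>
  have same2: "r x < r y \<longleftrightarrow> r2 x < r2 y" if xy: "x \<in> V2" "y \<in> V2" for x y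
  proof -
    have uniq: "u = v" if "u \<in> V1 \<inter> V2" "v \<in> V1 \<inter> V2" for u v
      using r2(1,3) that by (meson IntE dual_order.antisym inj_onD)
    have strict: "r2 v < r2 u" if "v \<in> V1 \<inter> V2" "u \<in> V2" "u \<notin> V1" for u v
      using r2(1) r2(3)[OF that(1,2)] that by (metis IntE inj_onD le_neq_implies_less)
    show ?thesis
    proof (cases "x \<in> V1"; cases "y \<in> V1")
      assume h: "x \<in> V1" "y \<in> V1"
      then have "x = y" using uniq xy by blast
      then show ?thesis by simp
    next
      assume h: "x \<in> V1" "y \<notin> V1"
      then show ?thesis using strict[of x y] xy M[OF h(1)] unfolding r_def by simp
    next
      assume h: "x \<notin> V1" "y \<in> V1"
      then show ?thesis using strict[of y x] xy M[OF h(2)] unfolding r_def by simp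
    next
      assume h: "x \<notin> V1" "y \<notin> V1"
      then show ?thesis unfolding r_def by simp
    qed
  qed
  show "inj_on r (V1 \<union> V2)"
  proof (rule inj_onI)
    fix x y assume xy: "x \<in> V1 \<union> V2" "y \<in> V1 \<union> V2" "r x = r y"
    have "x \<in> V1 \<longleftrightarrow> y \<in> V1" using in1[of x] in1[of y] xy(3) by simp
    then show "x = y"
      using xy inj_onD[OF r1(1), of x y] inj_onD[OF r2(1), of x y] by (cases "x \<in> V1") (auto simp: r_def)
  qed
  show "noncrossing_order E r"
    unfolding noncrossing_order_def
  proof (intro allI impI notI)
    fix a b c d assume e: "{a, b} \<in> E" "{c, d} \<in> E" and o: "r a < r c \<and> r c < r b \<and> r b < r d"
    have min1: "\<not> r u < r v" if "v \<in> V1 \<inter> V2" "u \<in> V1" for u v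
      using r1(3)[OF that] same1[of u v] that by simp
    consider "{a, b} \<subseteq> V1" "{c, d} \<subseteq> V1" | "{a, b} \<subseteq> V2" "{c, d} \<subseteq> V2" | "{a, b} \<subseteq> V1" "{c, d} \<subseteq> V2"
      | "{a, b} \<subseteq> V2" "{c, d} \<subseteq> V1" using edges[OF e(1)] edges[OF e(2)] by blast
    then show False
    proof cases
      case 1
      then show False using noncrossing_orderD[OF r1(2), of a b c d] e o same1 by auto
    next
      case 2
      then show False using noncrossing_orderD[OF r2(2), of a b c d] e o same2 by auto
    next
      case 3
      then have "r b < M" using in1 by simp
      then have "c \<in> V1" using o in1[of c] by simp
      then show False using min1[of c a] 3 o by auto
    next
      case 4
      then have "r d < M" using in1 by simp
      then have "b \<in> V1" using o in1[of b] by simp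
      then show False using min1[of b c] 4 o by auto
    qed
  qed
qed

text \<open>
Loops are cut out as soon as they close, which keeps the vertices distinct.
\<close>

lemma path_of_rtrancl:
  assumes "(a, b) \<in> R\<^sup>*"
  shows "\<exists>P. P \<noteq> [] \<and> hd P = a \<and> last P = b \<and> distinct P \<and> walk_edges P \<subseteq> {{x, y} |x y. (x, y) \<in> R} \<and>
    (\<forall>x\<in>set P. (a, x) \<in> R\<^sup>*)"
  using assms
proof (induction rule: rtrancl_induct)
  case base
  show ?case by (intro exI[of _ "[a]"]) auto
next
  case (step y z)
  then obtain P where P: "P \<noteq> []" "hd P = a" "last P = y" "distinct P"
      "walk_edges P \<subseteq> {{x, y} |x y. (x, y) \<in> R}" "\<forall>x\<in>set P. (a, x) \<in> R\<^sup>*" by blast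
  show ?case
  proof (cases "z \<in> set P")
    case True
    then obtain P1 P2 where P12: "P = P1 @ z # P2" using split_list by metis
    have "walk_edges (P1 @ [z]) \<subseteq> walk_edges P" unfolding P12 using walk_edges_append[of P1 z P2] by blast
    then show ?thesis using P unfolding P12
      by (intro exI[of _ "P1 @ [z]"]) (auto simp: hd_append split: if_splits)
  next
    case False
    obtain P' where P': "P = P' @ [y]" using P(1,3) by (metis append_butlast_last_id)
    have "walk_edges (P @ [z]) = walk_edges P \<union> {{y, z}}"
      using walk_edges_append[of P' y "[z]"] unfolding P' by simp
    moreover have "(a, z) \<in> R\<^sup>*" using step by simp
    ultimately show ?thesis using P False step(2)
      by (intro exI[of _ "P @ [z]"]) (auto simp: hd_append)
  qed
qed

text \<open>
A cycle given by its list of vertices. Length \<open>2\<close> is included on purpose, as an edge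
traversed back and forth: it serves as the first cycle in the search for a longest one.
\<close>

definition closed_walk :: "'a set set \<Rightarrow> 'a list \<Rightarrow> bool" where
  "closed_walk E L \<longleftrightarrow> distinct L \<and> 2 \<le> length L \<and> walk_edges (L @ [hd L]) \<subseteq> E"

lemma closed_walk_rotate:
  assumes "closed_walk E (X @ y # Y)" shows "closed_walk E (y # Y @ X)"
proof (cases X)
  case Nil then show ?thesis using assms by simp
next
  case (Cons x X')
  have "walk_edges ((y # Y @ X) @ [y]) = walk_edges (y # Y @ [x]) \<union> walk_edges (X @ [y])"
    using walk_edges_append[of "y # Y" x "X' @ [y]"] unfolding Cons by simp
  moreover have "walk_edges ((X @ y # Y) @ [x]) = walk_edges (X @ [y]) \<union> walk_edges (y # Y @ [x])"
    using walk_edges_append[of X y "Y @ [x]"] by simp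
  ultimately show ?thesis using assms unfolding closed_walk_def Cons by auto
qed

text \<open>
A cycle seen as two walks between two of its vertices.
\<close>

lemma closed_walk_iff:
  "closed_walk E (c # A @ d # B) \<longleftrightarrow>
     distinct (c # A @ d # B) \<and> walk_edges (c # A @ [d]) \<subseteq> E \<and> walk_edges (c # rev B @ [d]) \<subseteq> E"
proof -
  have "walk_edges (c # A @ d # B @ [c]) = walk_edges (c # A @ [d]) \<union> walk_edges (d # B @ [c])"
    using walk_edges_append[of "c # A" d "B @ [c]"] by simp
  then show ?thesis
    using walk_edges_rev[of "d # B @ [c]"] unfolding closed_walk_def by simp
qed

text \<open>
Connected graphs split exactly at cut vertices; disconnected graphs split with an empty overlap.
\<close>

definition splits :: "'a set \<Rightarrow> 'a set set \<Rightarrow> bool" where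
  "splits V E \<longleftrightarrow> (\<exists>V1 V2 v. V1 \<union> V2 = V \<and> V1 \<noteq> V \<and> V2 \<noteq> V \<and> V1 \<inter> V2 \<subseteq> {v} \<and>
     (\<forall>e\<in>E. e \<subseteq> V1 \<or> e \<subseteq> V2))"

text \<open>
Let \<open>K\<close> be the component, outside the cycle, of a vertex missed by the cycle. It is attached to the cycle in
at least two vertices, as the graph would split otherwise. A path through \<open>K\<close>
between two of them is an ear: if its ends are consecutive on the cycle, then the cycle can be
lengthened, and if not, then the ear and the two halves of the cycle form a theta graph.
\<close>

lemma longest_closed_walk_spans:
  assumes fin: "finite V" and edges: "\<And>e. e \<in> E \<Longrightarrow> e \<subseteq> V \<and> card e = 2"
    and insep: "\<not> splits V E"
    and no_theta: "\<And>c d A B C. distinct (c # d # A @ B @ C) \<Longrightarrow> A \<noteq> [] \<Longrightarrow> B \<noteq> [] \<Longrightarrow> C \<noteq> [] \<Longrightarrow>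
      walk_edges (c # A @ [d]) \<subseteq> E \<Longrightarrow> walk_edges (c # B @ [d]) \<subseteq> E \<Longrightarrow> walk_edges (c # C @ [d]) \<subseteq> E \<Longrightarrow> False"
    and L: "closed_walk E L" "set L \<subseteq> V" and longest: "\<And>L'. closed_walk E L' \<Longrightarrow> length L' \<le> length L"
  shows "set L = V"
proof (rule ccontr)
  assume "set L \<noteq> V"
  then obtain x where x: "x \<in> V" "x \<notin> set L" using L(2) by blast
  define R where "R = {(a, b). {a, b} \<in> E \<and> a \<notin> set L \<and> b \<notin> set L}"
  define K where "K = {y. (x, y) \<in> R\<^sup>*}"
  \<comment> \<open>N is the set of attachment vertices of the component K.\<close>
  define N where "N = {c \<in> set L. \<exists>k\<in>K. {k, c} \<in> E}"
  have xK: "x \<in> K" unfolding K_def by simp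
  have KL: "y \<notin> set L \<and> y \<in> V" if "y \<in> K" for y
  proof -
    have "(x, y) \<in> R\<^sup>*" using that unfolding K_def by simp
    then show ?thesis using x edges by (induction rule: rtrancl_induct) (auto simp: R_def)
  qed
  have "\<exists>c\<in>N. \<exists>d\<in>N. c \<noteq> d"
  proof (rule ccontr)
    assume "\<not> ?thesis"
    then obtain v where v: "N \<subseteq> {v}" by blast
    have "\<not> set L \<subseteq> {v}"
    proof
      assume "set L \<subseteq> {v}"
      then have "card (set L) \<le> 1" using card_mono[of "{v}" "set L"] by simp
      then show False using L(1) distinct_card[of L] unfolding closed_walk_def by simp
    qed
    then have "K \<union> N \<noteq> V" using v KL L(2) unfolding N_def by blast
    moreover have "e \<subseteq> K \<union> N \<or> e \<subseteq> V - K" if e: "e \<in> E" for e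
    proof -
      obtain a b where ab: "e = {a, b}" using edges[OF e] card_2_iff by metis
      have *: "b \<in> K \<union> N" if "a \<in> K" "{a, b} \<in> E" for a b
      proof (cases "b \<in> set L")
        case True then show ?thesis using that unfolding N_def by blast
      next
        case False
        then have "(a, b) \<in> R" using that KL unfolding R_def by blast
        then show ?thesis using that(1) unfolding K_def by (auto intro: rtrancl_into_rtrancl)
      qed
      have "{b, a} \<in> E" using e ab by (simp add: insert_commute)
      then show ?thesis using *[of a b] *[of b a] e edges[OF e] unfolding ab by auto
    qed
    moreover have "(K \<union> N) \<union> (V - K) = V" "V - K \<noteq> V" "(K \<union> N) \<inter> (V - K) \<subseteq> {v}"
      using v KL L(2) xK x unfolding N_def by auto
    ultimately have "splits V E" unfolding splits_def by blast
    then show False using insep by simp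
  qed
  then obtain c d k k' where cd: "c \<in> set L" "d \<in> set L" "c \<noteq> d" "k \<in> K" "k' \<in> K" "{k, c} \<in> E" "{k', d} \<in> E"
    unfolding N_def by blast
  have "sym R" unfolding R_def sym_def by (auto simp: insert_commute)
  then have "(k, k') \<in> R\<^sup>*"
    using cd(4,5) unfolding K_def by (metis mem_Collect_eq rtrancl_trans sym_rtrancl symD)
  from path_of_rtrancl[OF this] obtain P where P: "P \<noteq> []" "hd P = k" "last P = k'" "distinct P"
    "walk_edges P \<subseteq> {{x, y} |x y. (x, y) \<in> R}" "\<forall>x\<in>set P. (k, x) \<in> R\<^sup>*" by blast
  have PK: "set P \<subseteq> K" using P(6) cd(4) unfolding K_def by (auto intro: rtrancl_trans)
  have PE: "walk_edges P \<subseteq> E" using P(5) unfolding R_def by blast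
  obtain P' where P': "P = P' @ [k']" using P(1,3) by (metis append_butlast_last_id)
  have ear: "walk_edges (c # P @ [d]) \<subseteq> E"
  proof -
    have "walk_edges (c # P @ [d]) = insert {c, k} (walk_edges (P @ [d]))"
      using walk_edges_Cons[of "P @ [d]" c] P(1,2) by simp
    also have "walk_edges (P @ [d]) = walk_edges P \<union> {{k', d}}"
      using walk_edges_append[of P' k' "[d]"] unfolding P' by simp
    finally show ?thesis using PE cd by (auto simp: insert_commute)
  qed
  obtain X Y where XY: "L = X @ c # Y" using cd(1) split_list by metis
  have "d \<in> set (Y @ X)" using cd(2,3) unfolding XY by auto
  then obtain A B where AB: "Y @ X = A @ d # B" using split_list by metis
  have setL: "set L = set (c # A @ d # B)" and lenL: "length L = length (c # A @ d # B)"
    unfolding AB[symmetric] XY by auto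
  have L': "closed_walk E (c # A @ d # B)"
    using closed_walk_rotate[of E X c Y] L(1) unfolding XY AB by simp
  note cyc = L'[unfolded closed_walk_iff]
  have dist: "distinct (c # d # A @ B @ P)" using cyc P(4) PK KL setL by auto
  show False
  proof (cases "A = []")
    case True
    have "closed_walk E (c # P @ d # B)" unfolding closed_walk_iff using cyc ear dist by auto
    from longest[OF this] show False using P(1) lenL True by (cases P) auto
  next
    case neA: False
    show False
    proof (cases "B = []")
      case True
      have "closed_walk E (c # P @ d # rev A)" unfolding closed_walk_iff using cyc ear dist by auto
      from longest[OF this] show False using P(1) lenL True by (cases P) auto
    next
      case False
      show False
        by (rule no_theta[of c d A "rev B" P]) (use dist neA False P(1) cyc ear in auto)
    qed
  qed
qed

text \<open>
Along a cycle through all vertices, edges that cross in the order are chords that cross in the cycle.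
\<close>

lemma spanning_closed_walk_order:
  assumes edges: "\<And>e. e \<in> E \<Longrightarrow> e \<subseteq> set L" and L: "closed_walk E L"
    and no_cross: "\<And>c d A B a b. distinct (c # d # A @ B) \<Longrightarrow> walk_edges (c # A @ [d]) \<subseteq> E \<Longrightarrow>
      walk_edges (c # B @ [d]) \<subseteq> E \<Longrightarrow> {c, d} \<in> E \<Longrightarrow> {a, b} \<in> E \<Longrightarrow> a \<in> set A \<Longrightarrow> b \<in> set B \<Longrightarrow> False"
  obtains r :: "'a \<Rightarrow> nat" where "inj_on r (set L)" "noncrossing_order E r"
proof
  have dist: "distinct L" using L unfolding closed_walk_def by simp
  define r where "r = the_inv_into {..<length L} ((!) L)"
  have r: "r (L ! i) = i" if "i < length L" for i
    unfolding r_def using that dist by (intro the_inv_into_f_f) (auto simp: inj_on_def nth_eq_iff_index_eq)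
  have Lr: "x = L ! r x \<and> r x < length L" if "x \<in> set L" for x
    using that r by (metis in_set_conv_nth)
  show "inj_on r (set L)" using Lr by (metis inj_onI)
  show "noncrossing_order E r"
    unfolding noncrossing_order_def
  proof (intro allI impI notI)
    fix a b c d assume e: "{a, b} \<in> E" "{c, d} \<in> E" and o: "r a < r c \<and> r c < r b \<and> r b < r d"
    have V: "a \<in> set L" "b \<in> set L" "c \<in> set L" "d \<in> set L" using edges e by auto
    have split: "L = take (r a) L @ a # drop (Suc (r a)) L"
      using id_take_nth_drop[of "r a" L] Lr[OF V(1)] by simp
    let ?M = "drop (Suc (r a)) L" and ?j = "r b - Suc (r a)"
    have nth: "x = ?M ! (r x - Suc (r a)) \<and> r x - Suc (r a) < length ?M" if "x \<in> set L" "r a < r x" for x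
      using Lr[OF that(1)] that(2) by auto
    have jb: "b = ?M ! ?j \<and> ?j < length ?M" by (rule nth) (use V o in auto)
    then have splitM: "?M = take ?j ?M @ b # drop (Suc ?j) ?M"
      using id_take_nth_drop[of ?j ?M] by simp
    have "c = take ?j ?M ! (r c - Suc (r a)) \<and> r c - Suc (r a) < length (take ?j ?M)"
      using nth[OF V(3)] o jb by auto
    then have c: "c \<in> set (take ?j ?M)" using nth_mem by metis
    have "d = drop (Suc ?j) ?M ! (r d - Suc (r b)) \<and> r d - Suc (r b) < length (drop (Suc ?j) ?M)"
      using Lr[OF V(4)] o by auto
    then have d: "d \<in> set (drop (Suc ?j) ?M)" using nth_mem by metis
    \<comment> \<open>The part of the cycle from b around the end of the list back to a.\<close>
    let ?B = "drop (Suc ?j) ?M @ take (r a) L"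
    have "closed_walk E (a # ?M @ take (r a) L)"
      by (rule closed_walk_rotate) (use L split in simp)
    then have "closed_walk E (a # take ?j ?M @ b # ?B)" using splitM by (metis append_Cons append_assoc)
    note cyc = this[unfolded closed_walk_iff]
    show False
      by (rule no_cross[of a b "take ?j ?M" "rev ?B" c d]) (use cyc e c d in auto)
  qed
qed

text \<open>
The two excluded configurations are inherited by induced subgraphs, so the two parts of a graph that
splits have noncrossing orders by induction on the number of vertices. A graph that does not split has a
cycle through all vertices, along which no chords cross.
\<close>

theorem noncrossing_order_exists:
  assumes "finite V" and "\<And>e. e \<in> E \<Longrightarrow> e \<subseteq> V \<and> card e = 2"
    and "\<And>c d A B C. distinct (c # d # A @ B @ C) \<Longrightarrow> A \<noteq> [] \<Longrightarrow> B \<noteq> [] \<Longrightarrow> C \<noteq> [] \<Longrightarrow>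
      walk_edges (c # A @ [d]) \<subseteq> E \<Longrightarrow> walk_edges (c # B @ [d]) \<subseteq> E \<Longrightarrow> walk_edges (c # C @ [d]) \<subseteq> E \<Longrightarrow> False"
    and "\<And>c d A B a b. distinct (c # d # A @ B) \<Longrightarrow> walk_edges (c # A @ [d]) \<subseteq> E \<Longrightarrow>
      walk_edges (c # B @ [d]) \<subseteq> E \<Longrightarrow> {c, d} \<in> E \<Longrightarrow> {a, b} \<in> E \<Longrightarrow> a \<in> set A \<Longrightarrow> b \<in> set B \<Longrightarrow> False"
  shows "\<exists>r :: 'a \<Rightarrow> nat. inj_on r V \<and> noncrossing_order E r"
  using assms
proof (induction "card V" arbitrary: V E rule: less_induct)
  case less
  note fin = less.prems(1) and edges = less.prems(2) and no_theta = less.prems(3) and no_cross = less.prems(4)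
  consider "splits V E" | "card V \<le> 1" | "\<not> splits V E" "2 \<le> card V" by linarith
  then show ?case
  proof cases
    case 1
    then obtain V1 V2 v where S: "V1 \<union> V2 = V" "V1 \<noteq> V" "V2 \<noteq> V" "V1 \<inter> V2 \<subseteq> {v}"
      "\<And>e. e \<in> E \<Longrightarrow> e \<subseteq> V1 \<or> e \<subseteq> V2" unfolding splits_def by metis
    have part: "\<exists>r :: 'a \<Rightarrow> nat. inj_on r W \<and> noncrossing_order {e \<in> E. e \<subseteq> W} r \<and> (\<forall>u\<in>W. r v \<le> r u)"
      if W: "W \<subset> V" for W
    proof -
      have finW: "finite W" using W fin finite_subset by blast
      have "\<exists>r :: 'a \<Rightarrow> nat. inj_on r W \<and> noncrossing_order {e \<in> E. e \<subseteq> W} r"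
      proof (rule less.hyps)
        show "card W < card V" using W fin psubset_card_mono by blast
        show "finite W" by fact
        show "e \<subseteq> W \<and> card e = 2" if "e \<in> {e \<in> E. e \<subseteq> W}" for e using that edges by blast
        show False if "distinct (c # d # A @ B @ C)" "A \<noteq> []" "B \<noteq> []" "C \<noteq> []"
          "walk_edges (c # A @ [d]) \<subseteq> {e \<in> E. e \<subseteq> W}" "walk_edges (c # B @ [d]) \<subseteq> {e \<in> E. e \<subseteq> W}"
          "walk_edges (c # C @ [d]) \<subseteq> {e \<in> E. e \<subseteq> W}" for c d A B C
          by (rule no_theta[OF that(1-4)]) (use that in blast)+
        show False if "distinct (c # d # A @ B)" "walk_edges (c # A @ [d]) \<subseteq> {e \<in> E. e \<subseteq> W}"
          "walk_edges (c # B @ [d]) \<subseteq> {e \<in> E. e \<subseteq> W}" "{c, d} \<in> {e \<in> E. e \<subseteq> W}" "{a, b} \<in> {e \<in> E. e \<subseteq> W}"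
          "a \<in> set A" "b \<in> set B" for c d A B a b
          by (rule no_cross[OF that(1) _ _ _ _ that(6,7)]) (use that in blast)+
      qed
      then obtain r :: "'a \<Rightarrow> nat" where r: "inj_on r W" "noncrossing_order {e \<in> E. e \<subseteq> W} r" by blast
      obtain r' where "inj_on r' W" "noncrossing_order {e \<in> E. e \<subseteq> W} r'" "\<And>u. u \<in> W \<Longrightarrow> r' v \<le> r' u"
        by (rule rotate_noncrossing_order[OF finW _ r, of v]) auto
      then show ?thesis by blast
    qed
    have W: "V1 \<subset> V" "V2 \<subset> V" using S by auto
    obtain r1 :: "'a \<Rightarrow> nat" where r1: "inj_on r1 V1" "noncrossing_order {e \<in> E. e \<subseteq> V1} r1" "\<forall>u\<in>V1. r1 v \<le> r1 u"
      using part[OF W(1)] by blast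
    obtain r2 :: "'a \<Rightarrow> nat" where r2: "inj_on r2 V2" "noncrossing_order {e \<in> E. e \<subseteq> V2} r2" "\<forall>u\<in>V2. r2 v \<le> r2 u"
      using part[OF W(2)] by blast
    have "finite V1" using W(1) fin finite_subset by blast
    then obtain r :: "'a \<Rightarrow> nat" where "inj_on r (V1 \<union> V2)" "noncrossing_order E r"
      by (rule glue_noncrossing_orders[OF _ S(5) r1(1,2) _ r2(1,2)]) (use r1(3) r2(3) S(4) in blast)+
    then show ?thesis using S(1) by blast
  next
    case 2
    have "E = {}"
    proof (rule ccontr)
      assume "E \<noteq> {}"
      then obtain e where "e \<subseteq> V" "card e = 2" using edges by blast
      then show False using 2 card_mono[OF fin, of e] by simp
    qed
    moreover have "inj_on (\<lambda>_. 0 :: nat) V" using 2 fin by (auto simp: inj_on_def card_le_Suc0_iff_eq)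
    ultimately show ?thesis unfolding noncrossing_order_def by blast
  next
    case 3
    obtain x where x: "x \<in> V" using 3(2) by fastforce
    have "\<exists>e\<in>E. \<not> e \<subseteq> {x} \<and> \<not> e \<subseteq> V - {x}"
    proof (rule ccontr)
      assume "\<not> ?thesis"
      then have "{x} \<union> (V - {x}) = V \<and> {x} \<noteq> V \<and> V - {x} \<noteq> V \<and> {x} \<inter> (V - {x}) \<subseteq> {x} \<and>
          (\<forall>e\<in>E. e \<subseteq> {x} \<or> e \<subseteq> V - {x})"
        using x 3(2) by auto
      then show False using 3(1) unfolding splits_def by metis
    qed
    then obtain e where e: "e \<in> E" by blast
    then obtain u w where uw: "e = {u, w}" "u \<noteq> w" using edges card_2_iff by metis
    have start: "closed_walk E [u, w]" using e uw unfolding closed_walk_def by (auto simp: insert_commute)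
    have inV: "set L \<subseteq> V" if cw: "closed_walk E L" for L
    proof
      fix y assume "y \<in> set L"
      then obtain e where "e \<in> walk_edges (L @ [hd L])" "y \<in> e"
        using vertex_in_walk_edge[of y "L @ [hd L]"] cw unfolding closed_walk_def by auto
      moreover from this have "e \<in> E" using cw unfolding closed_walk_def by blast
      ultimately show "y \<in> V" using edges by blast
    qed
    have bound: "length L \<le> card V" if "closed_walk E L" for L
      using card_mono[OF fin inV[OF that]] that distinct_card[of L] unfolding closed_walk_def by simp
    have "\<exists>L. closed_walk E L \<and> (\<forall>L'. closed_walk E L' \<longrightarrow> length L' \<le> length L)"
    proof (rule ex_has_greatest_nat)
      show "closed_walk E [u, w]" by (fact start)
      show "\<forall>L. closed_walk E L \<longrightarrow> length L < Suc (card V)" using bound by (simp add: less_Suc_eq_le)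
    qed
    then obtain L where L: "closed_walk E L" and longest: "\<And>L'. closed_walk E L' \<Longrightarrow> length L' \<le> length L"
      by metis
    have span: "set L = V"
      by (rule longest_closed_walk_spans[OF fin edges 3(1) no_theta L inV[OF L] longest])
    show ?thesis
    proof (rule spanning_closed_walk_order[OF _ L no_cross])
      show "e \<subseteq> set L" if "e \<in> E" for e using edges that span by blast
    qed (use span in blast)+
  qed
qed

section \<open>Drawing a noncrossing order on a parabola\<close>

lemma convex_parabola: "convex {z :: complex. (Re z)\<^sup>2 \<le> Im z}"
proof (rule convexI)
  fix x y :: complex and u v :: real
  assume h: "x \<in> {z. (Re z)\<^sup>2 \<le> Im z}" "y \<in> {z. (Re z)\<^sup>2 \<le> Im z}" "0 \<le> u" "0 \<le> v" "u + v = 1"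
  have "(u * Re x + v * Re y)\<^sup>2 \<le> u * (Re x)\<^sup>2 + v * (Re y)\<^sup>2"
  proof -
    have v: "v = 1 - u" using h(5) by simp
    have "u * (Re x)\<^sup>2 + v * (Re y)\<^sup>2 - (u * Re x + v * Re y)\<^sup>2 = u * v * (Re x - Re y)\<^sup>2"
      unfolding v by (simp add: power2_eq_square algebra_simps)
    moreover have "0 \<le> u * v * (Re x - Re y)\<^sup>2" using h by simp
    ultimately show ?thesis by linarith
  qed
  also have "\<dots> \<le> u * Im x + v * Im y"
    using h by (intro add_mono mult_left_mono) auto
  finally show "u *\<^sub>R x + v *\<^sub>R y \<in> {z. (Re z)\<^sup>2 \<le> Im z}" by simp
qed

definition parabola_point :: "real \<Rightarrow> complex" where
  "parabola_point t = Complex t (t\<^sup>2)"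

text \<open>
The line through the points of the parabola over \<open>s\<close> and \<open>t\<close> is the graph of
\<open>x \<mapsto> (s + t) x - s t\<close>.
\<close>

lemma chord_iff:
  assumes "s < t"
  shows "z \<in> closed_segment (parabola_point s) (parabola_point t) \<longleftrightarrow>
    s \<le> Re z \<and> Re z \<le> t \<and> Im z = (s + t) * Re z - s * t"
proof
  assume "z \<in> closed_segment (parabola_point s) (parabola_point t)"
  then obtain u where u: "0 \<le> u" "u \<le> 1" "z = (1 - u) *\<^sub>R parabola_point s + u *\<^sub>R parabola_point t"
    by (auto simp: closed_segment_def)
  have re: "Re z = s + u * (t - s)" unfolding u(3) parabola_point_def by (simp add: algebra_simps)
  have im: "Im z = (s + t) * Re z - s * t" 
    unfolding re unfolding u(3) parabola_point_def by (simp add: algebra_simps power2_eq_square)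
  have "u * (t - s) \<le> 1 * (t - s)" using u assms by (intro mult_right_mono) auto
  then have "Re z \<le> t" using re by simp
  moreover have "s \<le> Re z" using re u(1) assms by simp
  ultimately show "s \<le> Re z \<and> Re z \<le> t \<and> Im z = (s + t) * Re z - s * t" using im by blast
next
  assume h: "s \<le> Re z \<and> Re z \<le> t \<and> Im z = (s + t) * Re z - s * t"
  define u where "u = (Re z - s) / (t - s)"
  have u: "0 \<le> u" "u \<le> 1" using h assms unfolding u_def by auto
  have re: "Re z = s + u * (t - s)" using assms unfolding u_def by simp
  have "z = (1 - u) *\<^sub>R parabola_point s + u *\<^sub>R parabola_point t"
  proof (rule complex_eqI)
    show "Re z = Re ((1 - u) *\<^sub>R parabola_point s + u *\<^sub>R parabola_point t)"
      unfolding parabola_point_def re by (simp add: algebra_simps)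
    have "Im z = (s + t) * (s + u * (t - s)) - s * t" using h re by simp
    then show "Im z = Im ((1 - u) *\<^sub>R parabola_point s + u *\<^sub>R parabola_point t)"
      unfolding parabola_point_def by (simp add: algebra_simps power2_eq_square)
  qed
  then show "z \<in> closed_segment (parabola_point s) (parabola_point t)"
    using u by (auto simp: closed_segment_def)
qed

lemma parabola_point_on_chord:
  assumes "s < t" "parabola_point x \<in> closed_segment (parabola_point s) (parabola_point t)"
  shows "x = s \<or> x = t"
proof -
  have "x\<^sup>2 = (s + t) * x - s * t" using assms chord_iff[OF assms(1)] unfolding parabola_point_def by simp
  then have "(x - s) * (x - t) = 0" by (simp add: algebra_simps power2_eq_square)
  then show ?thesis by simp
qed

text \<open>
Noncrossing intervals are side by side or nested. In the nested case the height of the chord over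
\<open>s\<close> and \<open>t\<close> above the parabola at \<open>x\<close> is
\<open>(x - s) (t - x)\<close>, which decreases when the interval shrinks, strictly so except at a
common end.
\<close>

lemma noncrossing_chords_Int:
  assumes st: "s < t" "s' < t'" and nc: "\<not> (s < s' \<and> s' < t \<and> t < t')" "\<not> (s' < s \<and> s < t' \<and> t' < t)"
    and z: "z \<in> closed_segment (parabola_point s) (parabola_point t)" "z \<in> closed_segment (parabola_point s') (parabola_point t')"
    and ne: "(s, t) \<noteq> (s', t')"
  shows "\<exists>x. z = parabola_point x \<and> x \<in> {s, t} \<and> x \<in> {s', t'}"
proof -
  note c = z(1)[unfolded chord_iff[OF st(1)]] z(2)[unfolded chord_iff[OF st(2)]]
  have point: "z = parabola_point s" if "Re z = s" using that c(1) unfolding parabola_point_def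
    by (intro complex_eqI) (auto simp: algebra_simps power2_eq_square)
  have point': "z = parabola_point t" if "Re z = t" using that c(1) unfolding parabola_point_def
    by (intro complex_eqI) (auto simp: algebra_simps power2_eq_square)
  have nested: "Re z \<in> {s, t} \<and> Re z \<in> {s', t'}"
    if h: "s \<le> s'" "t' \<le> t" "(s, t) \<noteq> (s', t')" "s' < t'" 
      "s' \<le> Re z" "Re z \<le> t'" "(s + t) * Re z - s * t = (s' + t') * Re z - s' * t'" for s t s' t' :: real
  proof -
    define x where "x = Re z"
    have "(x - s) * (t - x) = (x - s') * (t' - x)"
      using h(7) unfolding x_def by (simp add: algebra_simps)
    moreover have "(x - s) * (t - x) = (x - s') * (t' - x) + (s' - s) * (t - x) + (x - s') * (t - t')"
      by (simp add: algebra_simps)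
    moreover have "0 \<le> (s' - s) * (t - x)" "0 \<le> (x - s') * (t - t')"
      using h unfolding x_def by auto
    ultimately have "(s' - s) * (t - x) = 0" "(x - s') * (t - t') = 0" by linarith+
    then have "(s' = s \<or> x = t) \<and> (x = s' \<or> t = t')" by auto
    then show ?thesis using h unfolding x_def[symmetric] by auto
  qed
  consider "t \<le> s'" | "t' \<le> s" | "s \<le> s'" "t' \<le> t" | "s' \<le> s" "t \<le> t'" using nc st by linarith
  then show ?thesis
  proof cases
    case 1
    then have "Re z = t" "t = s'" using c by auto
    then show ?thesis using point' by auto
  next
    case 2
    then have "Re z = s" "s = t'" using c by auto
    then show ?thesis using point by auto
  next
    case 3
    have "Re z \<in> {s, t} \<and> Re z \<in> {s', t'}" by (rule nested) (use 3 ne st c in auto)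
    then show ?thesis using point point' by auto
  next
    case 4
    have "Re z \<in> {s', t'} \<and> Re z \<in> {s, t}" by (rule nested) (use 4 ne st c in auto)
    then show ?thesis using point point' by auto
  qed
qed

text \<open>
All chords lie above the parabola, so the convex set above it contains the drawing, and its
complement belongs to the unbounded face and touches every vertex.
\<close>

lemma noncrossing_order_imp_outerplanar:
  fixes r :: "'a \<Rightarrow> nat"
  assumes graph: "simple_graph V E" and inj: "inj_on r V" and nc: "noncrossing_order E r"
  shows "outerplanar V E"
proof -
  define p where "p = (\<lambda>v. parabola_point (real (r v)))"
  define ends where "ends = (\<lambda>e. SOME q. e = {fst q, snd q} \<and> r (fst q) < r (snd q))"
  define g where "g = (\<lambda>e. linepath (p (fst (ends e))) (p (snd (ends e))))"
  have edge: "\<exists>a b. e = {a, b} \<and> r a < r b \<and> a \<in> V \<and> b \<in> V \<and> ends e = (a, b)" if e: "e \<in> E" for e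
  proof -
    have "e \<subseteq> V" "card e = 2" using graph e unfolding simple_graph_def by auto
    then obtain a b where ab: "e = {a, b}" "a \<noteq> b" "a \<in> V" "b \<in> V" by (auto simp: card_2_iff)
    then have "r a \<noteq> r b" using inj by (meson inj_onD)
    then have "\<exists>q. e = {fst q, snd q} \<and> r (fst q) < r (snd q)"
      using ab(1) by (metis fst_conv insert_commute nat_neq_iff snd_conv)
    then have "e = {fst (ends e), snd (ends e)} \<and> r (fst (ends e)) < r (snd (ends e))"
      unfolding ends_def by (rule someI_ex)
    moreover from this have "fst (ends e) \<in> V" "snd (ends e) \<in> V" using \<open>e \<subseteq> V\<close> by auto
    ultimately show ?thesis by (metis prod.collapse)
  qed
  have inj_p: "p u = p v \<longleftrightarrow> u = v" if "u \<in> V" "v \<in> V" for u v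
    using inj that unfolding p_def parabola_point_def by (auto simp: inj_on_def)
  have img: "path_image (g e) = closed_segment (p a) (p b)" if "ends e = (a, b)" for e a b
    using that unfolding g_def by simp
  have "plane_drawing V E p g"
    unfolding plane_drawing_def
  proof (intro conjI ballI impI)
    show "inj_on p V" using inj_p by (auto simp: inj_on_def)
  next
    fix e assume "e \<in> E"
    then obtain a b where ab: "e = {a, b}" "r a < r b" "a \<in> V" "b \<in> V" "ends e = (a, b)" using edge by blast
    have "p a \<noteq> p b" using inj_p ab by auto
    then show "arc (g e)" unfolding g_def using ab by simp
    show "{pathstart (g e), pathfinish (g e)} = p ` e" unfolding g_def using ab by simp
    show "path_image (g e) \<inter> p ` V \<subseteq> p ` e"
    proof
      fix z assume "z \<in> path_image (g e) \<inter> p ` V"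
      then obtain v where v: "v \<in> V" "z = p v" "p v \<in> closed_segment (p a) (p b)" using img[OF ab(5)] by auto
      then have "real (r v) = real (r a) \<or> real (r v) = real (r b)"
        using parabola_point_on_chord[of "real (r a)" "real (r b)" "real (r v)"] ab(2) unfolding p_def by simp
      then show "z \<in> p ` e" using v(2) ab(1) unfolding p_def by auto
    qed
  next
    fix e f assume ef: "e \<in> E" "f \<in> E" "e \<noteq> f"
    obtain a b where ab: "e = {a, b}" "r a < r b" "a \<in> V" "b \<in> V" "ends e = (a, b)" using edge[OF ef(1)] by blast
    obtain c d where cd: "f = {c, d}" "r c < r d" "c \<in> V" "d \<in> V" "ends f = (c, d)" using edge[OF ef(2)] by blast
    show "path_image (g e) \<inter> path_image (g f) \<subseteq> p ` (e \<inter> f)"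
    proof
      fix z assume "z \<in> path_image (g e) \<inter> path_image (g f)"
      then have z: "z \<in> closed_segment (parabola_point (real (r a))) (parabola_point (real (r b)))"
        "z \<in> closed_segment (parabola_point (real (r c))) (parabola_point (real (r d)))"
        using img[OF ab(5)] img[OF cd(5)] unfolding p_def by auto
      have "(real (r a), real (r b)) \<noteq> (real (r c), real (r d))"
        using ef(3) inj_onD[OF inj _ ab(3) cd(3)] inj_onD[OF inj _ ab(4) cd(4)] ab(1) cd(1) by auto
      moreover have "\<not> (r a < r c \<and> r c < r b \<and> r b < r d)" "\<not> (r c < r a \<and> r a < r d \<and> r d < r b)"
        using noncrossing_orderD[OF nc] ef(1,2) unfolding ab(1) cd(1) by blast+
      ultimately obtain x where x: "z = parabola_point x" "x \<in> {real (r a), real (r b)}" "x \<in> {real (r c), real (r d)}"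
        using noncrossing_chords_Int[OF _ _ _ _ z] ab(2) cd(2) by (metis of_nat_less_iff)
      from x(2) obtain v where v: "v \<in> e" "x = real (r v)" using ab(1) by auto
      from x(3) obtain w where w: "w \<in> f" "x = real (r w)" using cd(1) by auto
      have "v \<in> V" "w \<in> V" using v w ab cd by auto
      then have "v = w" using v w inj by (simp add: inj_on_eq_iff)
      then show "z \<in> p ` (e \<inter> f)" using v w x(1) unfolding p_def by auto
    qed
  qed
  moreover have "p ` V \<subseteq> frontier (outside (drawn_set V E p g))"
  proof
    fix z assume z: "z \<in> p ` V"
    let ?H = "{z :: complex. (Re z)\<^sup>2 \<le> Im z}"
    let ?D = "drawn_set V E p g"
    have pH: "p v \<in> ?H" for v unfolding p_def parabola_point_def by simp
    have "?D \<subseteq> ?H"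
      unfolding drawn_set_def
    proof (intro Un_least UN_least)
      show "p ` V \<subseteq> ?H" using pH by auto
      show "path_image (g e) \<subseteq> ?H" if "e \<in> E" for e
        using edge[OF that] img closed_segment_subset[OF pH pH convex_parabola] by metis
    qed
    then have out: "- ?H \<subseteq> outside ?D"
      using outside_mono[of ?D ?H] outside_convex[OF convex_parabola] by simp
    have "z \<in> closure (outside ?D)"
      unfolding closure_approachable
    proof (intro allI impI)
      fix e :: real assume e: "0 < e"
      obtain v where v: "z = p v" using z by blast
      \<comment> \<open>A point just below the parabola.\<close>
      let ?w = "Complex (Re z) (Im z - e / 2)"
      have "?w \<in> - ?H" using e unfolding v p_def parabola_point_def by simp
      moreover have "dist ?w z < e"
      proof -
        have "?w - z = Complex 0 (- (e / 2))" by (simp add: complex_eq_iff)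
        then show ?thesis using e by (simp add: dist_norm complex_norm)
      qed
      ultimately show "\<exists>y\<in>outside ?D. dist y z < e" using out by blast
    qed
    moreover have "z \<notin> interior (outside ?D)"
      using z interior_subset outside_no_overlap[of ?D] unfolding drawn_set_def by blast
    ultimately show "z \<in> frontier (outside ?D)" unfolding frontier_def by blast
  qed
  ultimately show ?thesis unfolding outerplanar_def by blast
qed

section \<open>Triangulations of a polygon\<close>

text \<open>
Each of the patterns of period \<open>4\<close> by which positions are coloured changes under a step
by \<open>2\<close>, so that the two sides of a vertex get different colours.
\<close>

lemma mod_4_cases:
  fixes k :: int
  shows "((k + 1) mod 4 < 2) \<noteq> ((k - 1) mod 4 < 2)"
    and "((k + 2) mod 4 < 2) \<noteq> (k mod 4 < 2)"
    and "((k + 2) mod 4 = 0 \<or> (k + 2) mod 4 = 3) \<noteq> (k mod 4 = 0 \<or> k mod 4 = 3)"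
    and "even k \<Longrightarrow> ((k + 1) mod 4 = 3) \<noteq> ((k - 1) mod 4 = 3)"
  by presburger+

lemma parity_if_distance_1_mod_4:
  assumes "\<bar>int i - int j\<bar> mod 4 = 1" shows "even i \<noteq> even j"
proof -
  have "odd k" if "k mod 4 = 1" for k :: int using that by presburger
  from this[OF assms] show ?thesis by simp
qed

text \<open>
Two neighbours of a rigid vertex \<open>u\<close> on the same side of \<open>u\<close> differ by a
multiple of \<open>4\<close>.
\<close>

lemma same_side_mod_4:
  fixes u j k :: int
  assumes "\<bar>u - j\<bar> mod 4 = 1" "\<bar>u - k\<bar> mod 4 = 1" "u < j \<and> u < k \<or> j < u \<and> k < u"
  shows "(k - j) mod 4 = 0"
proof -
  have "(j - u) mod 4 = 1 \<and> (k - u) mod 4 = 1 \<or> (u - j) mod 4 = 1 \<and> (u - k) mod 4 = 1"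
    using assms by auto
  then show ?thesis by presburger
qed

text \<open>
A chord has two lengths, \<open>g\<close> and \<open>m - g\<close>, one for each way around the polygon.
The residues that matter below do not depend on the way.
\<close>

lemma complement_mod_4:
  fixes o' g m :: int
  assumes "o' = g \<or> o' = m - g"
  shows "m mod 4 = 2 \<Longrightarrow> odd g \<Longrightarrow> o' mod 4 = g mod 4"
    and "m mod 4 = 3 \<Longrightarrow> g mod 4 = 0 \<or> g mod 4 = 3 \<Longrightarrow> o' mod 4 = 0 \<or> o' mod 4 = 3"
  using assms by presburger+

text \<open>
Edges of a triangulated polygon with corners \<open>0, ..., n - 1\<close>, described as a maximal
noncrossing relation. The sides of the polygon and the triangles follow from maximality.
\<close>

locale polygon_triangulation =
  fixes n :: nat and A :: "nat \<Rightarrow> nat \<Rightarrow> bool"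
  assumes order: "n \<ge> 4"
    and sym: "A i j \<Longrightarrow> A j i"
    and range: "A i j \<Longrightarrow> i < n"
    and irrefl: "\<not> A i i"
    and noncrossing: "A i k \<Longrightarrow> A j l \<Longrightarrow> i < j \<Longrightarrow> j < k \<Longrightarrow> k < l \<Longrightarrow> False"
    and maximal: "i < j \<Longrightarrow> j < n \<Longrightarrow> \<not> A i j \<Longrightarrow>
      \<exists>k l. A k l \<and> (i < k \<and> k < j \<and> j < l \<or> k < i \<and> i < l \<and> l < j)"
begin

lemma range': "A i j \<Longrightarrow> j < n"
  using sym range by blast

lemma side: assumes "Suc i < n" shows "A i (Suc i)"
proof (rule ccontr)
  assume "\<not> A i (Suc i)"
  from maximal[OF _ assms this] obtain k l where "i < k \<and> k < Suc i \<or> i < l \<and> l < Suc i" by auto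
  then show False by auto
qed

lemma closing_side: "A 0 (n - 1)"
proof (rule ccontr)
  assume *: "\<not> A 0 (n - 1)"
  have "0 < n - 1" "n - 1 < n" using order by auto
  from maximal[OF this *] obtain k l where "A k l" "n - 1 < l" by auto
  with range' show False by fastforce
qed

text \<open>
The third corner is the last neighbour of \<open>i\<close> before \<open>j\<close>; a chord keeping it
from being adjacent to \<open>j\<close> would have to cross an edge or give a later neighbour.
\<close>

lemma inner_triangle:
  assumes "A i j" "Suc i < j"
  obtains k where "i < k" "k < j" "A i k" "A k j"
proof -
  have jn: "j < n" using range'[OF assms(1)] .
  define S where "S = {k. i < k \<and> k < j \<and> A i k}"
  have fS: "finite S" unfolding S_def by simp
  have "Suc i \<in> S" using assms side[of i] jn unfolding S_def by auto
  define k where "k = Max S"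
  have kS: "k \<in> S" and km: "\<And>x. x \<in> S \<Longrightarrow> x \<le> k"
    using fS \<open>Suc i \<in> S\<close> by (auto simp: k_def intro: Max_in)
  have k: "i < k" "k < j" "A i k" using kS unfolding S_def by auto
  have "A k j"
  proof (rule ccontr)
    assume "\<not> A k j"
    then obtain s t where st: "A s t" "k < s \<and> s < j \<and> j < t \<or> s < k \<and> k < t \<and> t < j"
      using maximal[of k j] k jn by blast
    from st(2) show False
    proof
      assume h: "k < s \<and> s < j \<and> j < t"
      then show False using noncrossing[OF assms(1) st(1)] k by linarith
    next
      assume h: "s < k \<and> k < t \<and> t < j"
      consider "s < i" | "s = i" | "i < s" by linarith
      then show False
      proof cases
        case 1 then show False using noncrossing[OF st(1) assms(1)] h k by linarith
      next
        case 2 then have "t \<in> S" using st(1) h k unfolding S_def by auto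
        then show False using km h by force
      next
        case 3 then show False using noncrossing[OF k(3) st(1)] h by linarith
      qed
    qed
  qed
  then show ?thesis using that k by blast
qed

text \<open>
Take the shortest other edge that encloses \<open>i, j\<close>. Its inner triangle has its third corner
outside the interval between \<open>i\<close> and \<open>j\<close>, so one side of that triangle still
encloses this interval and must be the edge itself.
\<close>

lemma outer_triangle:
  assumes "A i j" "i < j" "\<not> (i = 0 \<and> j = n - 1)"
  obtains k where "k < i \<or> j < k" "A k i" "A k j"
proof -
  \<comment> \<open>The lengths of the edges that enclose the given one.\<close>
  define enc where "enc = (\<lambda>l. \<exists>a b. A a b \<and> a \<le> i \<and> j \<le> b \<and> \<not> (a = i \<and> b = j) \<and> b - a = l)"
  have "j \<le> n - 1" using range'[OF assms(1)] by simp
  then have "enc (n - 1)" unfolding enc_def using closing_side assms by force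
  define l where "l = (LEAST l. enc l)"
  have "enc l" unfolding l_def using \<open>enc (n - 1)\<close> by (rule LeastI)
  then obtain a b where ab: "A a b" "a \<le> i" "j \<le> b" "\<not> (a = i \<and> b = j)" "b - a = l"
    unfolding enc_def by blast
  have least: "a' = i \<and> b' = j" if "A a' b'" "a' \<le> i" "j \<le> b'" "b' - a' < l" for a' b'
    using that not_less_Least[of "b' - a'" enc] unfolding l_def enc_def by blast
  have "Suc a < b" using ab assms(2) by auto
  then obtain k where k: "a < k" "k < b" "A a k" "A k b" using inner_triangle ab(1) by blast
  have "\<not> (i < k \<and> k < j)"
  proof
    assume h: "i < k \<and> k < j"
    show False
    proof (cases "a < i")
      case True then show False using noncrossing[OF k(3) assms(1)] h by simp
    next
      case False then have "j < b" using ab by auto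
      then show False using noncrossing[OF assms(1) k(4)] h by simp
    qed
  qed
  then consider "k \<le> i" | "j \<le> k" by linarith
  then show ?thesis
  proof cases
    case 1
    have "k = i \<and> b = j" using least[OF k(4) 1 ab(3)] k ab(5) by linarith
    then show ?thesis using that[of a] k ab(1) by simp
  next
    case 2
    have "a = i \<and> k = j" using least[OF k(3) ab(2) 2] k ab(5) by linarith
    then show ?thesis using that[of b] k ab(1) sym by simp
  qed
qed

lemma common_neighbour:
  assumes "A i j" obtains k where "A i k" "A j k"
proof -
  have *: "\<exists>k. A i k \<and> A j k" if ij: "A i j" "i < j" for i j
  proof (cases "i = 0 \<and> j = n - 1")
    case True
    then have "Suc i < j" using order by simp
    then obtain k where "A i k" "A k j" using inner_triangle ij(1) by blast
    then show ?thesis using sym by blast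
  next
    case False then show ?thesis using outer_triangle[OF that] sym by metis
  qed
  show ?thesis using *[of i j] *[of j i] assms irrefl sym that
    by (metis nat_neq_iff)
qed

text \<open>
The shortest edge that spans more than a side cuts off a single corner.
\<close>

lemma ear_exists: obtains i where "A i (i + 2)"
proof -
  have "\<exists>i. A i (i + 2)" if "A i j" "Suc i < j" for i j
    using that
  proof (induction "j - i" arbitrary: i j rule: less_induct)
    case less
    obtain k where k: "i < k" "k < j" "A i k" "A k j" using inner_triangle less.prems by blast
    consider "Suc i < k" | "Suc k < j" | "j = i + 2" using k by linarith
    then show ?case
    proof cases
      case 1 then show ?thesis using less.hyps[of k i] k by (meson diff_less_mono less_imp_le)
    next
      case 2 then show ?thesis using less.hyps[of j k] k by (meson diff_less_mono2 less_trans)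
    next
      case 3 then show ?thesis using less.prems by blast
    qed
  qed
  moreover have "Suc 0 < n - 1" using order by simp
  ultimately show ?thesis using closing_side that by blast
qed

section \<open>Colourings in which every vertex sees both colours\<close>

definition sees_both :: "(nat \<Rightarrow> bool) \<Rightarrow> nat \<Rightarrow> bool" where
  "sees_both f i \<longleftrightarrow> (\<exists>j k. A i j \<and> A i k \<and> f j \<noteq> f k)"

definition succ where "succ i = (if Suc i = n then 0 else Suc i)"
definition pred where "pred i = (if i = 0 then n - 1 else i - 1)"

lemma A_succ: "i < n \<Longrightarrow> A i (succ i)"
  using side[of i] closing_side sym order by (auto simp: succ_def)
lemma A_pred: "i < n \<Longrightarrow> A i (pred i)"
  using side[of "i - 1"] closing_side sym order by (auto simp: pred_def)

lemma sees_both_if_sides_differ: "i < n \<Longrightarrow> f (succ i) \<noteq> f (pred i) \<Longrightarrow> sees_both f i"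
  using A_succ A_pred unfolding sees_both_def by blast

lemma sees_both_if_neighbour: "i < n \<Longrightarrow> A i j \<Longrightarrow> f j \<noteq> f (succ i) \<Longrightarrow> sees_both f i"
  using A_succ unfolding sees_both_def by blast

abbreviation gap :: "nat \<Rightarrow> nat \<Rightarrow> int" where "gap i j \<equiv> \<bar>int i - int j\<bar> mod 4"


text \<open>
The number of steps from \<open>x\<close> to \<open>i\<close> along the polygon in increasing direction,
between \<open>0\<close> and \<open>n - 1\<close>. As an integer, it can be decremented without
truncation.
\<close>

definition offset :: "nat \<Rightarrow> nat \<Rightarrow> int" where
  "offset x i = int i - int x + (if i < x then int n else 0)"

lemma succ_less: "i < n \<Longrightarrow> succ i < n" and pred_less: "i < n \<Longrightarrow> pred i < n"
  using order by (auto simp: succ_def pred_def)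

lemma offset_pred: "i < n \<Longrightarrow> x < n \<Longrightarrow> i \<noteq> x \<Longrightarrow> offset x (pred i) = offset x i - 1"
  by (auto simp: offset_def pred_def)

lemma offset_succ: "i < n \<Longrightarrow> x < n \<Longrightarrow> succ i \<noteq> x \<Longrightarrow> offset x (succ i) = offset x i + 1"
  by (auto simp: offset_def succ_def split: if_splits)

lemma offset_last: "i < n \<Longrightarrow> x < n \<Longrightarrow> succ i = x \<Longrightarrow> offset x i = int n - 1"
  by (auto simp: offset_def succ_def split: if_splits)

lemma offset_self [simp]: "offset x x = 0"
  by (simp add: offset_def)

lemma offset_succ_self: "x < n \<Longrightarrow> offset x (succ x) = 1"
  using order by (auto simp: offset_def succ_def)

lemma offset_gap: "offset x j = \<bar>int x - int j\<bar> \<or> offset x j = int n - \<bar>int x - int j\<bar>"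
  by (auto simp: offset_def)

lemma colouring_mod_0:
  assumes "n mod 4 = 0"
  shows "\<exists>f. \<forall>i<n. sees_both f i"
proof -
  define f where "f = (\<lambda>i. offset 0 i mod 4 < 2)"
  have nn: "int n mod 4 = 0" using assms by presburger
  have "sees_both f i" if i: "i < n" for i
  proof (rule sees_both_if_sides_differ[OF i])
    have n0: "0 < n" using order by simp
    have "offset 0 (succ i) mod 4 = (offset 0 i + 1) mod 4"
      using offset_succ[OF i n0] offset_last[OF i n0] nn by (cases "succ i = 0") auto
    moreover have "offset 0 (pred i) mod 4 = (offset 0 i - 1) mod 4"
      using offset_pred[OF i n0] nn order by (cases "i = 0") (auto simp: pred_def offset_def mod_simps, presburger)
    ultimately show "f (succ i) \<noteq> f (pred i)"
      unfolding f_def using mod_4_cases(1)[of "offset 0 i"] by simp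
  qed
  then show ?thesis by blast
qed

text \<open>
Colour each position by a pattern of period \<open>4\<close> in its offset from \<open>x\<close>. Then
the two sides of every vertex except \<open>x\<close> get different colours; the condition on
\<open>P (int n - 2)\<close> takes care of the last position before \<open>x\<close>. At
\<open>x\<close> the neighbour \<open>y\<close> provides the missing colour.
\<close>

lemma single_fault_colouring:
  fixes P :: "int \<Rightarrow> bool"
  assumes x: "x < n" and P: "\<And>k. P (k + 2) \<noteq> P k" "P (int n - 2) \<noteq> P 0"
    and y: "A x y" "P (offset x y) \<noteq> P 1"
  shows "\<exists>f. \<forall>i<n. sees_both f i"
proof -
  define f where "f = (\<lambda>i. P (offset x i))"
  have "sees_both f i" if i: "i < n" for i
  proof (cases "i = x")
    case True
    have "f y \<noteq> f (succ x)" using y(2) offset_succ_self[OF x] by (simp add: f_def)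
    then show ?thesis unfolding True using sees_both_if_neighbour x y(1) by blast
  next
    case False
    have "f (succ i) \<noteq> f (pred i)"
    proof (cases "succ i = x")
      case True
      then show ?thesis
        using P(2) offset_last[OF i x] offset_pred[OF i x False] by (simp add: f_def)
    next
      case ne: False
      then show ?thesis
        using P(1)[of "offset x i - 1"] offset_succ[OF i x] offset_pred[OF i x False]
        by (simp add: f_def add.commute)
    qed
    then show ?thesis using sees_both_if_sides_differ[OF i] by blast
  qed
  then show ?thesis by blast
qed

text \<open>
The vertex next to an ear has a neighbour at offset \<open>2\<close>, which has the colour that its two
sides lack.
\<close>

lemma colouring_mod_1:
  assumes "n mod 4 = 1"
  shows "\<exists>f. \<forall>i<n. sees_both f i"
proof -
  obtain x where x: "A x (x + 2)" using ear_exists .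
  have nn: "int n mod 4 = 1" using assms by presburger
  show ?thesis
  proof (rule single_fault_colouring[of x "\<lambda>k. k mod 4 < 2", OF range[OF x] _ _ x])
    show "((k + 2) mod 4 < 2) \<noteq> (k mod 4 < 2)" for k :: int
      by (rule mod_4_cases)
    show "((int n - 2) mod 4 < 2) \<noteq> ((0::int) mod 4 < 2)" using nn by presburger
    show "(offset x (x + 2) mod 4 < 2) \<noteq> ((1::int) mod 4 < 2)" by (simp add: offset_def)
  qed
qed

text \<open>
Here the vertex to be repaired needs a neighbour at distance \<open>0\<close> or \<open>3\<close> modulo
\<open>4\<close>. Behind an ear there is a second triangle, whose two outer sides have lengths
differing by \<open>2\<close> modulo \<open>4\<close>, so one of them will do.
\<close>

lemma colouring_mod_3:
  assumes "n mod 4 = 3"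
  shows "\<exists>f. \<forall>i<n. sees_both f i"
proof -
  have nn: "int n mod 4 = 3" using assms by presburger
  obtain x y where xy: "A x y" "gap x y = 0 \<or> gap x y = 3"
  proof -
    obtain e where e: "A e (e + 2)" using ear_exists .
    have "\<not> (e = 0 \<and> e + 2 = n - 1)" using assms order by auto
    then obtain k where k: "k < e \<or> e + 2 < k" "A k e" "A k (e + 2)"
      using outer_triangle[OF e] by auto
    define g where "g = \<bar>int k - int e\<bar>"
    have "\<bar>int k - int (e + 2)\<bar> = g + 2 \<or> \<bar>int k - int (e + 2)\<bar> = g - 2" unfolding g_def using k(1) by auto
    then have "gap k (e + 2) = (g + 2) mod 4"
    proof
      assume "\<bar>int k - int (e + 2)\<bar> = g - 2"
      moreover have "(g - 2) mod 4 = (g + 2) mod 4" by presburger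
      ultimately show ?thesis by simp
    qed simp
    then have "gap k e = 0 \<or> gap k e = 3 \<or> gap k (e + 2) = 0 \<or> gap k (e + 2) = 3"
      using mod_4_cases(3)[of g] unfolding g_def by metis
    then have "(gap k e = 0 \<or> gap k e = 3) \<or> (gap k (e + 2) = 0 \<or> gap k (e + 2) = 3)" by simp
    then show ?thesis using that[OF k(2)] that[OF k(3)] by (rule disjE)
  qed
  have x: "x < n" using range[OF xy(1)] .
  show ?thesis
  proof (rule single_fault_colouring[of x "\<lambda>k. k mod 4 = 0 \<or> k mod 4 = 3", OF x _ _ xy(1)])
    show "((k + 2) mod 4 = 0 \<or> (k + 2) mod 4 = 3) \<noteq> (k mod 4 = 0 \<or> k mod 4 = 3)" for k :: int
      by (rule mod_4_cases)
    show "((int n - 2) mod 4 = 0 \<or> (int n - 2) mod 4 = 3) \<noteq> ((0::int) mod 4 = 0 \<or> (0::int) mod 4 = 3)"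
    proof -
      have "(int n - 2) mod 4 = 1" using nn by presburger
      then show ?thesis by simp
    qed
    have "offset x y mod 4 = 0 \<or> offset x y mod 4 = 3"
      using complement_mod_4(2)[OF offset_gap nn xy(2)] .
    then show "(offset x y mod 4 = 0 \<or> offset x y mod 4 = 3) \<noteq> ((1::int) mod 4 = 0 \<or> (1::int) mod 4 = 3)"
      by simp
  qed
qed

section \<open>Rigid vertices and the case of order 2 modulo 4\<close>

text \<open>
In a polygon of order \<open>2\<close> modulo \<open>4\<close> the condition on the distance does not depend on
the way around the polygon. It describes the vertices of degree \<open>2\<close> together with the
central ones.
\<close>

definition rigid :: "nat \<Rightarrow> bool" where
  "rigid i \<longleftrightarrow> (\<forall>j. A i j \<longrightarrow> gap i j = 1)"

lemma gap_commute: "gap i j = gap j i"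
  by (simp add: abs_minus_commute)

text \<open>
The three sides of a triangle on this edge would all have odd length, which no three integers allow.
\<close>

lemma adjacent_not_both_rigid:
  assumes "A i j" "rigid i" "rigid j" shows False
proof -
  obtain k where k: "A i k" "A j k" using common_neighbour assms(1) .
  then have "gap i j = 1" "gap i k = 1" "gap j k = 1" using assms unfolding rigid_def by auto
  then show False using parity_if_distance_1_mod_4 by blast
qed

text \<open>
The vertices of the parity opposite to \<open>x\<close> alternate in colour with a fault across
\<open>x\<close>, and those of the parity opposite to \<open>y\<close> with a fault across
\<open>y\<close>. The bit \<open>s\<close> exchanges the colours of the second class, so it adjusts
the two classes to each other.
\<close>

lemma double_fault_colouring:
  fixes s :: bool
  assumes n: "n mod 4 = 2" and x: "x < n" and y: "y < n" and par: "even x \<noteq> even y"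
  defines "f \<equiv> (\<lambda>i. if even i \<noteq> even x then offset x i mod 4 = 3 else (offset y i mod 4 = 3) \<noteq> s)"
  assumes j: "A x j" "f j" and k: "A y k" "f k \<noteq> s"
  shows "\<forall>i<n. sees_both f i"
proof (intro allI impI)
  have nn: "int n mod 4 = 2" "even n" using n by presburger+
  fix i assume i: "i < n"
  have sp: "even (succ i) \<noteq> even i" "even (pred i) \<noteq> even i"
    using nn(2) i by (auto simp: succ_def pred_def)
  have 1: "(offset z (succ i) mod 4 = 3) \<noteq> (offset z (pred i) mod 4 = 3)"
    if z: "z < n" "i \<noteq> z" "even i = even z" for z
  proof -
    have "succ i \<noteq> z" using sp z by auto
    then have "offset z (succ i) = offset z i + 1" "offset z (pred i) = offset z i - 1"
      using offset_succ offset_pred i z by auto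
    moreover have "even (offset z i)" using z(3) nn(2) by (auto simp: offset_def)
    ultimately show ?thesis using mod_4_cases(4)[of "offset z i"] by simp
  qed
  consider "i = x" | "i = y" | "i \<noteq> x" "even i = even x" | "i \<noteq> y" "even i = even y"
    using par by blast
  then show "sees_both f i"
  proof cases
    case 1
    have "\<not> f (succ x)" using sp offset_succ_self[OF x] unfolding f_def 1 by auto
    then show ?thesis using sees_both_if_neighbour[OF x j(1), of f] j(2) 1 by auto
  next
    case 2
    have "f (succ y) = s" using sp par offset_succ_self[OF y] unfolding f_def 2 by auto
    then show ?thesis using sees_both_if_neighbour[OF y k(1), of f] k(2) 2 by auto
  next
    case 3
    then have "f (succ i) \<noteq> f (pred i)" using 1[OF x] sp unfolding f_def by auto
    then show ?thesis using sees_both_if_sides_differ i by blast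
  next
    case 4
    then have "f (succ i) \<noteq> f (pred i)" using 1[OF y] sp par unfolding f_def by auto
    then show ?thesis using sees_both_if_sides_differ i by blast
  qed
qed

text \<open>
Put the two faults at the ends of the edge; each end has the colour that the sides of the other end
lack.
\<close>

lemma colouring_if_gap_3:
  assumes n: "n mod 4 = 2" and xy: "A x y" "gap x y = 3"
  shows "\<exists>f. \<forall>i<n. sees_both f i"
proof -
  have nn: "int n mod 4 = 2" using n by presburger
  have "odd k" if "k mod 4 = 3" for k :: int using that by presburger
  then have odd: "odd \<bar>int x - int y\<bar>" "odd \<bar>int y - int x\<bar>" using xy(2) gap_commute by metis+
  then have par: "even x \<noteq> even y" by simp
  have "offset x y mod 4 = 3" using complement_mod_4(1)[OF offset_gap nn odd(1)] xy(2) by simp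
  moreover have "offset y x mod 4 = 3" using complement_mod_4(1)[OF offset_gap nn odd(2)] xy(2) gap_commute by simp
  ultimately show ?thesis
    using double_fault_colouring[OF n range[OF xy(1)] range'[OF xy(1)] par, where s = False, OF xy(1) _ sym[OF xy(1)]] par
    by auto
qed

text \<open>
With the faults at \<open>p\<close> and \<open>q\<close>, the vertices \<open>p'\<close> and
\<open>q'\<close> are to repair them. All edges between the parity classes have length
\<open>1\<close> modulo \<open>4\<close>, and this fixes the colours of \<open>p'\<close> and
\<open>q'\<close> so that both repairs succeed for the same choice of \<open>s\<close>.
\<close>

lemma colouring_if_two_coloured_quadrilateral:
  assumes n: "n mod 4 = 2" and no3: "\<And>x y. A x y \<Longrightarrow> gap x y \<noteq> 3"
    and par: "even p \<noteq> even q" "even p' = even p" "even q' = even q"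
    and A: "A p p'" "A q q'" "A p q'" "A q p'"
  shows "\<exists>f. \<forall>i<n. sees_both f i"
proof -
  have nn: "int n mod 4 = 2" using n by presburger
  have odd: "odd \<bar>int q - int p'\<bar>" "odd \<bar>int p - int q'\<bar>" using par by auto
  have "offset q p' mod 4 \<noteq> 3" using complement_mod_4(1)[OF offset_gap nn odd(1)] no3[OF A(4)] by simp
  moreover have "offset p q' mod 4 \<noteq> 3" using complement_mod_4(1)[OF offset_gap nn odd(2)] no3[OF A(3)] by simp
  ultimately show ?thesis
    using double_fault_colouring[OF n range[OF A(1)] range[OF A(2)] par(1), where s = True, OF A(1) _ A(2)] par
    by auto
qed

text \<open>
Call the parity of the majority of the corners of a triangle its type. If no two triangles on a common
edge between the parity classes have different types, then below an edge \<open>a b\<close> every edge with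
ends of equal parity has the parity of the type of the triangle \<open>a z b\<close>. The hypothesis
\<open>quad\<close> expresses the exclusion of different types in terms of the four corners involved.
\<close>

lemma same_parity_edges_agree:
  assumes quad: "\<And>p q p' q'. even p \<noteq> even q \<Longrightarrow> even p' = even p \<Longrightarrow> even q' = even q \<Longrightarrow>
      A p p' \<Longrightarrow> A q q' \<Longrightarrow> A p q' \<Longrightarrow> A q p' \<Longrightarrow> False"
    and ab: "A a b" and z: "a < z" "z < b" "A a z" "A z b"
    and uv: "A u v" "even u = even v" "a \<le> u" "u < v" "v \<le> b"
    and st: "s \<in> {a, z, b}" "t \<in> {a, z, b}" "s \<noteq> t" "even s = even t"
  shows "even s = even u"
  using ab z uv st
proof (induction "b - a" arbitrary: a b z s t rule: less_induct)
  case less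
  note p = less.prems
  \<comment> \<open>Two triangles on the edge x y whose third corners have different parities.\<close>
  have apex: False if h: "even x \<noteq> even y" "even v \<noteq> even w" "A x v" "A y v" "A x w" "A y w" for x y v w
  proof (cases "even v = even x")
    case True
    have "even w = even y" using h(1,2) True by blast
    then show False using quad[OF h(1) True _ h(3,6,5,4)] by blast
  next
    case False
    then have "even v = even y" "even w = even x" using h(1,2) by blast+
    then show False using quad[of y x v w] h by blast
  qed
  have IH: "even s' = even u" if "A a' b'" "a \<le> a'" "a' \<le> u" "v \<le> b'" "b' \<le> b" "b' - a' < b - a"
      "a' < w" "w < b'" "A a' w" "A w b'" "s' \<in> {a', w, b'}" "t' \<in> {a', w, b'}" "s' \<noteq> t'" "even s' = even t'"
    for a' b' w s' t'
    using less.hyps[of b' a' w s' t'] that p by auto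
  consider "u = a" "v = b" | "v \<le> z" | "z \<le> u"
  proof -
    have False if "u < z" "z < v" "a < u \<or> v < b"
    proof (cases "a < u")
      case True then show False using noncrossing[OF p(4) p(6)] that by blast
    next
      case False then show False using noncrossing[OF p(6) p(5)] that by blast
    qed
    then have "u = a \<and> v = b \<or> v \<le> z \<or> z \<le> u" using p(8,10) by (meson le_antisym not_le)
    then show ?thesis using that by blast
  qed
  then show ?case
  proof cases
    case 1 then show ?thesis using p by auto
  next
    case 2
    have "v \<noteq> Suc u" using p(7) by auto
    then have "Suc a < z" using p(8,9) 2 by linarith
    then obtain w where w: "a < w" "w < z" "A a w" "A w z" using inner_triangle[OF p(4)] by blast
    have m: "even s' = even u" if "s' \<in> {a, w, z}" "t' \<in> {a, w, z}" "s' \<noteq> t'" "even s' = even t'" for s' t'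
      using IH[of a z w s' t'] that p w 2 by auto
    show ?thesis
    proof (cases "even a = even z")
      case True
      then have "even a = even u" using m[of a z] p by auto
      then show ?thesis using True p by auto
    next
      case False
      have wu: "even w = even u" using m[of w a] m[of w z] w p(2) False by auto
      show ?thesis
      proof (cases "even w = even b")
        case True
        have "even s = even b" using p(11-14) False by auto
        then show ?thesis using True wu by simp
      next
        case ne: False
        show ?thesis
          using apex[OF False ne w(3) sym[OF w(4)] p(1) p(5)] by blast
      qed
    qed
  next
    case 3
    have "v \<noteq> Suc u" using p(7) by auto
    then have "Suc z < b" using p(9,10) 3 by linarith
    then obtain w where w: "z < w" "w < b" "A z w" "A w b" using inner_triangle[OF p(5)] by blast
    have m: "even s' = even u" if "s' \<in> {z, w, b}" "t' \<in> {z, w, b}" "s' \<noteq> t'" "even s' = even t'" for s' t'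
      using IH[of z b w s' t'] that p w 3 by auto
    show ?thesis
    proof (cases "even b = even z")
      case True
      then have "even b = even u" using m[of b z] p by auto
      then show ?thesis using True p by auto
    next
      case False
      have wu: "even w = even u" using m[of w b] m[of w z] w p(2) False by auto
      show ?thesis
      proof (cases "even w = even a")
        case True
        have "even s = even a" using p(11-14) False by auto
        then show ?thesis using True wu by simp
      next
        case ne: False
        show ?thesis
          using apex[OF False ne sym[OF w(4)] w(3) sym[OF p(1)] sym[OF p(4)]] by blast
      qed
    qed
  qed
qed

text \<open>
If every edge between the parity classes has length \<open>1\<close> modulo \<open>4\<close>, a vertex
that is not rigid has an edge inside its own parity class. So both classes contain edges, and somewhere
the triangle type has to change.
\<close>

lemma colouring_mod_2:
  assumes n: "n mod 4 = 2"
    and x: "x < n" "even x" "\<not> rigid x" and y: "y < n" "odd y" "\<not> rigid y"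
  shows "\<exists>f. \<forall>i<n. sees_both f i"
proof (rule ccontr)
  assume none: "\<not> ?thesis"
  then have no3: "gap a b \<noteq> 3" if "A a b" for a b
    using colouring_if_gap_3[OF n that] by blast
  have quad: False if "even p \<noteq> even q" "even p' = even p" "even q' = even q"
      "A p p'" "A q q'" "A p q'" "A q p'" for p q p' q'
    using colouring_if_two_coloured_quadrilateral[OF n no3 that] none by blast
  \<comment> \<open>Without edges of length 3 modulo 4, a neighbour of the same parity is the only obstacle to rigidity.\<close>
  have same: "\<exists>u v. A u v \<and> u < v \<and> even u = even v \<and> even u = even i" if nb: "\<not> rigid i" for i
  proof -
    obtain j where j: "A i j" "gap i j \<noteq> 1" using nb unfolding rigid_def by blast
    have "even k" if "k mod 4 \<noteq> 1" "k mod 4 \<noteq> 3" for k :: int using that by presburger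
    from this[OF j(2) no3[OF j(1)]] have "even i = even j" by simp
    moreover have "i \<noteq> j" using j irrefl by blast
    ultimately show ?thesis using j(1) sym[OF j(1)] by (metis nat_neq_iff)
  qed
  obtain a a' where a: "A a a'" "a < a'" "even a" "even a'" using same[OF x(3)] x(2) by auto
  obtain b b' where b: "A b b'" "b < b'" "odd b" "odd b'" using same[OF y(3)] y(2) by auto
  obtain z where z: "0 < z" "z < n - 1" "A 0 z" "A z (n - 1)"
    using inner_triangle[OF closing_side] order by force
  have le: "a' \<le> n - 1" "b' \<le> n - 1" using range'[OF a(1)] range'[OF b(1)] by auto
  have "\<exists>s\<in>{0, z, n - 1}. \<exists>t\<in>{0, z, n - 1}. s \<noteq> t \<and> even s = even t"
    using z by auto
  then obtain s t where st: "s \<in> {0, z, n - 1}" "t \<in> {0, z, n - 1}" "s \<noteq> t" "even s = even t"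
    by blast
  have "even s = even a"
    by (rule same_parity_edges_agree[OF _ closing_side z a(1) _ _ a(2) le(1) st]) (fact quad | use a in simp)+
  moreover have "even s = even b"
    by (rule same_parity_edges_agree[OF _ closing_side z b(1) _ _ b(2) le(2) st]) (fact quad | use b in simp)+
  ultimately show False using a b by simp
qed

section \<open>Rigid vertices as an obstruction\<close>

text \<open>
Neighbours of \<open>u\<close> that are consecutive around \<open>u\<close> are adjacent, and a colour
change between \<open>j\<close> and \<open>k\<close> occurs between some consecutive pair.
\<close>

lemma consecutive_neighbours:
  assumes "A u j" "A u k" "j < k" "u < j \<or> k < u" "f j \<noteq> f k"
  obtains j' k' where "j \<le> j'" "j' < k'" "k' \<le> k" "A u j'" "A u k'" "A j' k'" "f j' \<noteq> (f k' :: bool)"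
proof -
  have "\<exists>j' k'. j \<le> j' \<and> j' < k' \<and> k' \<le> k \<and> A u j' \<and> A u k' \<and> A j' k' \<and> f j' \<noteq> f k'"
    using assms
  proof (induction "k - j" arbitrary: j k rule: less_induct)
    case less
    show ?case
    proof (cases "\<exists>m. j < m \<and> m < k \<and> A u m")
      case True
      then obtain m where m: "j < m" "m < k" "A u m" by blast
      define a b where "a = (if f j = f m then m else j)" and "b = (if f j = f m then k else m)"
      have ab: "A u a" "A u b" "a < b" "u < a \<or> b < u" "f a \<noteq> f b" "j \<le> a" "b \<le> k" "b - a < k - j"
        using less.prems m unfolding a_def b_def by auto
      obtain j' k' where "a \<le> j' \<and> j' < k' \<and> k' \<le> b \<and> A u j' \<and> A u k' \<and> A j' k' \<and> f j' \<noteq> f k'"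
        using less.hyps[OF ab(8,1-5)] by blast
      then show ?thesis using ab(6,7) by (meson order.trans)
    next
      case none: False
      have "A j k"
      proof (cases "u < j")
        case True
        then have "Suc u < k" using less.prems by simp
        then obtain z where z: "u < z" "z < k" "A u z" "A z k" using inner_triangle less.prems(2) by blast
        then have "z \<le> j" using none by force
        moreover have "\<not> z < j" using noncrossing[OF less.prems(1) z(4)] z less.prems by blast
        ultimately show ?thesis using z by simp
      next
        case False
        then have "k < u" "Suc j < u" using less.prems by auto
        then obtain z where z: "j < z" "z < u" "A j z" "A z u" using inner_triangle[OF sym[OF less.prems(1)]] by blast
        then have "k \<le> z" using none sym[OF z(4)] z(1) by (meson not_le)
        moreover have "\<not> k < z" using noncrossing[OF z(3) sym[OF less.prems(2)]] z less.prems by blast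
        ultimately show ?thesis using z by simp
      qed
      then show ?thesis using less.prems by blast
    qed
  qed
  then show ?thesis using that by blast
qed

text \<open>
A sequence of two values that changes at each step returns after an even number of steps.
\<close>

lemma alternate_parity:
  fixes f :: "nat \<Rightarrow> bool"
  assumes "\<And>i. i < m \<Longrightarrow> f (a + 2 * i) \<noteq> f (a + 2 * i + 2)"
  shows "f (a + 2 * m) = (f a = even m)"
  using assms by (induction m) auto

text \<open>
Infinite descent on the length of the edge. Suppose that the ends \<open>a\<close> and \<open>c\<close>
have different colours. There are evenly many steps by \<open>2\<close> from \<open>a\<close> to
\<open>c\<close>, so some step across a rigid vertex \<open>u\<close> preserves the colour. As
\<open>u\<close> sees both colours, there is a colour change among its neighbours on one side of it,
hence a shorter two-coloured edge whose length is again a multiple of \<open>4\<close>.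
\<close>

lemma no_bichromatic_edge:
  assumes rigid: "\<And>i. i < n \<Longrightarrow> odd (i + d) \<Longrightarrow> rigid i" and f: "\<And>i. i < n \<Longrightarrow> sees_both f i"
    and ac: "A a c" "a < c" "even (a + d)" "4 dvd (c - a)"
  shows "f a = f c"
  using ac
proof (induction "c - a" arbitrary: a c rule: less_induct)
  case less
  note p = less.prems
  show ?case
  proof (rule ccontr)
    assume ne: "f a \<noteq> f c"
    obtain m where m: "c = a + 4 * m" using p by (metis dvd_def le_add_diff_inverse less_imp_le)
    have "\<exists>i<2 * m. f (a + 2 * i) = f (a + 2 * i + 2)"
    proof (rule ccontr)
      assume "\<not> ?thesis"
      then have "f (a + 2 * (2 * m)) = (f a = even (2 * m))" by (intro alternate_parity) auto
      then show False using ne m by simp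
    qed
    then obtain i where i: "i < 2 * m" "f (a + 2 * i) = f (a + 2 * i + 2)" by blast
    define u where "u = a + 2 * i + 1"
    have u: "a < u" "u < c" "odd (u + d)" and fu: "f (u - 1) = f (u + 1)"
      using i m p(3) unfolding u_def by auto
    have un: "u < n" using u range'[OF p(1)] by simp
    have bu: "rigid u" using rigid un u by blast
    have conf: "a \<le> j \<and> j \<le> c" if "A u j" for j
      using noncrossing[OF p(1) that] noncrossing[OF sym[OF that] p(1)] u by (meson not_le)
    \<comment> \<open>A colour change on one side of u contradicts the induction hypothesis.\<close>
    have smaller: False if h: "A u j" "A u k" "j < k" "u < j \<or> k < u" "f j \<noteq> f k" for j k
    proof -
      obtain j' k' where jk: "j \<le> j'" "j' < k'" "k' \<le> k" "A u j'" "A u k'" "A j' k'" "f j' \<noteq> f k'"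
        using consecutive_neighbours[OF h] by blast
      have g: "gap u j' = 1" "gap u k' = 1" using bu jk unfolding rigid_def by auto
      have "(int k' - int j') mod 4 = 0"
        by (rule same_side_mod_4[OF g]) (use jk h in auto)
      then have d4: "4 dvd (k' - j')" using jk(2) by presburger
      have ev: "even (j' + d)" using parity_if_distance_1_mod_4[OF g(1)] u(3) by simp
      have "k' - j' < c - a" using conf[OF jk(4)] conf[OF jk(5)] jk(2) h(4) u jk(1,3) by linarith
      then show False using less.hyps[OF _ jk(6) jk(2) ev d4] jk(7) by blast
    qed
    obtain j k where jk: "A u j" "A u k" "f j \<noteq> f k" using f[OF un] unfolding sees_both_def by blast
    then obtain j where j: "A u j" "f j \<noteq> f (u + 1)" by metis
    have uu: "A u (u + 1)" "A u (u - 1)" using side[of u] side[of "u - 1"] sym u range'[OF p(1)] by auto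
    have "j \<noteq> u" using j irrefl by blast
    moreover have "j \<noteq> u + 1" "j \<noteq> u - 1" using j(2) fu by auto
    ultimately consider "u + 1 < j" | "j < u - 1" using u(1) by linarith
    then show False
    proof cases
      case 1 then show False using smaller[OF uu(1) j(1)] j(2) by auto
    next
      case 2 then show False using smaller[OF j(1) uu(2)] j(2) fu u by auto
    qed
  qed
qed

text \<open>
One of the ends of the side between \<open>n - 1\<close> and \<open>0\<close> is rigid. All its
neighbours are on one side of it in the linear order, and among them is a two-coloured edge.
\<close>

lemma no_colouring_if_class_rigid:
  assumes n: "n mod 4 = 2" and rigid: "\<And>i. i < n \<Longrightarrow> odd (i + d) \<Longrightarrow> rigid i" and f: "\<And>i. i < n \<Longrightarrow> sees_both f i"
  shows False
proof -
  have "odd (n - 1)" using n order by presburger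
  then have "odd (0 + d) \<or> odd (n - 1 + d)" by simp
  then obtain u where u: "u = 0 \<or> u = n - 1" "odd (u + d)" "u < n" using order by fastforce
  obtain j0 k0 where "A u j0" "A u k0" "f j0 \<noteq> f k0" using f[OF u(3)] unfolding sees_both_def by blast
  then obtain j k where jk: "A u j" "A u k" "j < k" "f j \<noteq> f k" by (metis nat_neq_iff)
  have "u \<noteq> j" "u \<noteq> k" "k < n" using jk(1,2) irrefl range'[OF jk(2)] by auto
  then have side: "u < j \<or> k < u" using u jk by auto
  obtain j' k' where jk': "j \<le> j'" "j' < k'" "k' \<le> k" "A u j'" "A u k'" "A j' k'" "f j' \<noteq> f k'"
    using consecutive_neighbours[OF jk(1-3) side jk(4)] by blast
  have g: "gap u j' = 1" "gap u k' = 1" using rigid[OF u(3) u(2)] jk' unfolding rigid_def by auto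
  have "(int k' - int j') mod 4 = 0"
    by (rule same_side_mod_4[OF g]) (use jk' side in auto)
  then have d4: "4 dvd (k' - j')" using jk'(2) by presburger
  have ev: "even (j' + d)" using parity_if_distance_1_mod_4[OF g(1)] u(2) by simp
  show False using no_bichromatic_edge[OF rigid f jk'(6,2) ev d4] jk'(7) by blast
qed

end

section \<open>Hamiltonian cycles and the count of rigid vertices\<close>

context polygon_triangulation
begin

lemma succ_pred: "i < n \<Longrightarrow> pred (succ i) = i" "i < n \<Longrightarrow> succ (pred i) = i"
  using order by (auto simp: succ_def pred_def)

lemma succ_mod: "i < n \<Longrightarrow> succ i = Suc i mod n"
  by (auto simp: succ_def)

text \<open>
The vertices strictly between the ends of a chord are not adjacent to those beyond it.
\<close>

lemma chord_separates:
  assumes "A a b" "A x y" "x \<notin> {a, b}" "y \<notin> {a, b}"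
  shows "(min a b < x \<and> x < max a b) = (min a b < y \<and> y < max a b)"
proof -
  have *: "a < y \<and> y < b" if "A a b" "A x y" "a < x" "x < b" "y \<notin> {a, b}" for a b x y
    using noncrossing[OF that(1,2)] noncrossing[OF sym[OF that(2)] that(1)] that(3-5) by force
  show ?thesis
  proof (cases "a < b")
    case True
    then show ?thesis using *[of a b x y] *[of a b y x] assms sym[OF assms(2)] by auto
  next
    case False
    have "b < a" using False irrefl assms(1) by (metis nat_neq_iff)
    then show ?thesis using *[of b a x y] *[of b a y x] assms sym[OF assms(2)] sym[OF assms(1)] by auto
  qed
qed

text \<open>
Suppose that a Hamiltonian cycle uses a chord. The rest of the cycle is a path that avoids the ends of
the chord, so it stays on one side of it; but the chord has vertices on both sides.
\<close>

lemma hamiltonian_step_is_side: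
  assumes bij: "bij_betw d {..<n} {..<n}" and adj: "\<And>i. i < n \<Longrightarrow> A (d i) (d (Suc i mod n))" and i: "i < n"
  shows "d (Suc i mod n) = succ (d i) \<or> d (Suc i mod n) = pred (d i)"
proof (rule ccontr)
  assume not_side: "\<not> ?thesis"
  \<comment> \<open>The cycle read from the step under consideration, which becomes the step from index 0 to 1.\<close>
  define e where "e = (\<lambda>m. d ((i + m) mod n))"
  have n: "0 < n" using order by simp
  have e01: "e 0 = d i" "e 1 = d (Suc i mod n)" using i unfolding e_def by auto
  have e_less: "e m < n" for m using bij n unfolding e_def bij_betw_def by auto
  have adj_e: "A (e m) (e (Suc m))" for m
    using adj[of "(i + m) mod n"] n unfolding e_def by (simp add: mod_Suc_eq)
  have e_inj: "m = m'" if "e m = e m'" "m < n" "m' < n" for m m'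
  proof -
    have "(i + m) mod n = (i + m') mod n"
      using that(1) bij n unfolding e_def bij_betw_def by (auto dest: inj_onD)
    moreover have "(i + k) mod n = (if i + k < n then i + k else i + k - n)" if "k < n" for k
      using i that by (simp add: mod_if)
    ultimately show ?thesis using that(2,3) by (auto split: if_splits)
  qed
  have e_surj: "\<exists>m<n. x = e m" if x: "x < n" for x
  proof -
    obtain j where j: "j < n" "x = d j" using bij x unfolding bij_betw_def by (metis imageE lessThan_iff)
    have "(i + (j + n - i) mod n) mod n = j" using i j(1) by (simp add: mod_add_right_eq)
    then show ?thesis using j n unfolding e_def by (intro exI[of _ "(j + n - i) mod n"]) simp
  qed
  define a b where "a = e 0" and "b = e 1"
  have ab: "A a b" using adj_e[of 0] unfolding a_def b_def by simp
  define enclosed where "enclosed = (\<lambda>x. min a b < x \<and> x < max a b)"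
  have avoid: "e m \<notin> {a, b}" if "2 \<le> m" "m < n" for m
    using e_inj[of m 0] e_inj[of m 1] that order unfolding a_def b_def by auto
  have const: "enclosed (e m) = enclosed (e 2)" if "2 \<le> m" "m < n" for m
    using that
  proof (induction m rule: dec_induct)
    case (step m)
    have "enclosed (e m) = enclosed (e (Suc m))"
      unfolding enclosed_def by (rule chord_separates[OF ab adj_e]) (use avoid step in auto)
    then show ?case using step by simp
  qed simp
  have all: "enclosed x = enclosed (e 2)" if x: "x < n" "x \<notin> {a, b}" for x
  proof -
    obtain m where m: "m < n" "x = e m" using e_surj[OF x(1)] by blast
    have "2 \<le> m"
    proof (rule ccontr)
      assume "\<not> 2 \<le> m"
      then have "m = 0 \<or> m = 1" by auto
      then show False using x(2) m(2) unfolding a_def b_def by auto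
    qed
    then show ?thesis using const[OF _ m(1)] m(2) by simp
  qed
  have lt: "a < n" "b < n" using e_less unfolding a_def b_def by auto
  have ns: "b \<noteq> succ a" "b \<noteq> pred a" using not_side e01 unfolding a_def b_def by auto
  then have ns': "a \<noteq> succ b" "a \<noteq> pred b" using succ_pred(1)[OF lt(2)] succ_pred(2)[OF lt(2)] by auto
  have ne: "a \<noteq> b" using ab irrefl by auto
  have "succ (min a b) < n" "pred (min a b) < n" using lt succ_less pred_less by (auto simp: min_def)
  moreover have "succ (min a b) \<notin> {a, b}" "pred (min a b) \<notin> {a, b}"
    using ns ns' lt order by (auto simp: min_def succ_def pred_def split: if_splits)
  moreover have "enclosed (succ (min a b))" "\<not> enclosed (pred (min a b))"
    using ns ns' lt order ne unfolding enclosed_def by (auto simp: min_def max_def succ_def pred_def split: if_splits)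
  ultimately show False using all[of "succ (min a b)"] all[of "pred (min a b)"] by blast
qed

text \<open>
By injectivity, a Hamiltonian cycle that moves along the sides never turns back. So up to its direction
it is the boundary of the polygon.
\<close>

lemma hamiltonian_offset:
  assumes bij: "bij_betw d {..<n} {..<n}" and adj: "\<And>i. i < n \<Longrightarrow> A (d i) (d (Suc i mod n))"
    and i: "0 < i" "i < n"
  shows "offset (d 0) (d i) = int i \<or> offset (d 0) (d i) = int n - int i"
proof -
  have n: "0 < n" using order by simp
  have less: "d i < n" if "i < n" for i using bij that unfolding bij_betw_def by auto
  have inj: "d i \<noteq> d j" if "i < n" "j < n" "i \<noteq> j" for i j
    using bij that unfolding bij_betw_def by (meson inj_onD lessThan_iff)
  have step: "d (Suc i) = succ (d i) \<or> d (Suc i) = pred (d i)" if "Suc i < n" for i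
    using hamiltonian_step_is_side[OF bij adj, of i] that by simp
  have keep_succ: "d (Suc i) = succ (d i)" if "Suc i < n" "d 1 = succ (d 0)" for i
    using that(1)
  proof (induction i)
    case (Suc i)
    have "d (Suc (Suc i)) \<noteq> d i" using inj Suc.prems by simp
    moreover have "pred (d (Suc i)) = d i" using Suc succ_pred(1) less by simp
    ultimately show ?case using step[OF Suc.prems] by auto
  qed (use that in simp)
  have keep_pred: "d (Suc i) = pred (d i)" if "Suc i < n" "d 1 = pred (d 0)" for i
    using that(1)
  proof (induction i)
    case (Suc i)
    have "d (Suc (Suc i)) \<noteq> d i" using inj Suc.prems by simp
    moreover have "succ (d (Suc i)) = d i" using Suc succ_pred(2) less by simp
    ultimately show ?case using step[OF Suc.prems] by auto
  qed (use that in simp)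
  consider "d 1 = succ (d 0)" | "d 1 = pred (d 0)" using step[of 0] order by auto
  then show ?thesis
  proof cases
    case 1
    have "offset (d 0) (d i) = int i" if "i < n" for i
      using that
    proof (induction i)
      case (Suc i)
      have "d (Suc i) = succ (d i)" using keep_succ[OF Suc.prems 1] .
      moreover have "d (Suc i) \<noteq> d 0" using inj[of "Suc i" 0] Suc.prems n by simp
      ultimately show ?case using offset_succ[of "d i" "d 0"] less[of i] less[OF n] Suc by simp
    qed simp
    then show ?thesis using i by simp
  next
    case 2
    have "offset (d 0) (d i) = int n - int i" if "0 < i" "i < n" for i
      using that
    proof (induction i)
      case (Suc i)
      show ?case
      proof (cases "i = 0")
        case True
        have "offset (d 0) (pred (d 0)) = int n - 1" 
          using less[OF n] order by (auto simp: offset_def pred_def)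
        then show ?thesis using 2 True by simp
      next
        case False
        have "d (Suc i) = pred (d i)" using keep_pred[OF Suc.prems(2) 2] .
        moreover have "d i \<noteq> d 0" using inj[of i 0] Suc.prems n False by simp
        ultimately show ?thesis using offset_pred[of "d i" "d 0"] less[of i] less[OF n] Suc False by simp
      qed
    qed simp
    then show ?thesis using i by simp
  qed
qed

lemma offset_gap_mod_2:
  assumes n: "n mod 4 = 2" and offset: "offset x y = k \<or> offset x y = int n - k"
  shows "gap x y = 1 \<longleftrightarrow> k mod 4 = 1"
proof -
  have nn: "int n mod 4 = 2" using n by presburger
  have g: "k = \<bar>int x - int y\<bar> \<or> k = int n - \<bar>int x - int y\<bar>" using offset offset_gap[of x y] by auto
  have "(k = h \<or> k = int n - h) \<Longrightarrow> h mod 4 = 1 \<longleftrightarrow> k mod 4 = 1" for h :: int using nn by presburger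
  from this[OF g] show ?thesis .
qed

text \<open>
The successor map sends rigid vertices injectively to vertices that are not rigid. If exactly half of the
vertices are rigid, it is a bijection between the two kinds, and then they alternate.
\<close>

lemma rigid_class_iff_card:
  assumes n: "n mod 4 = 2"
  shows "card {i. i < n \<and> rigid i} = n div 2 \<longleftrightarrow> (\<exists>d. \<forall>i<n. odd (i + d) \<longrightarrow> rigid i)"
proof
  let ?X = "{i. i < n \<and> rigid i}"
  have ev: "even n" using n by presburger
  assume card: "card ?X = n div 2"
  have inj: "inj_on succ ?X" by (rule inj_on_inverseI[where g = pred]) (simp add: succ_pred)
  have sub: "succ ` ?X \<subseteq> {..<n} - ?X"
    using adjacent_not_both_rigid[OF A_succ] succ_less by auto
  have "card ({..<n} - ?X) = n - card ?X" by (subst card_Diff_subset) auto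
  then have "card (succ ` ?X) = card ({..<n} - ?X)" using card card_image[OF inj] ev by auto
  then have eq: "succ ` ?X = {..<n} - ?X" using sub by (intro card_subset_eq) auto
  \<comment> \<open>A vertex that is not rigid is the successor of a rigid one, namely of its only predecessor.\<close>
  have alt: "rigid (Suc i) \<longleftrightarrow> \<not> rigid i" if i: "Suc i < n" for i
  proof
    show "\<not> rigid i" if "rigid (Suc i)" using adjacent_not_both_rigid[OF side[OF i]] that by blast
    show "rigid (Suc i)" if "\<not> rigid i"
    proof (rule ccontr)
      assume "\<not> rigid (Suc i)"
      then have "Suc i \<in> succ ` ?X" using eq i by auto
      then obtain j where "j < n" "rigid j" "succ j = Suc i" by auto
      then have "j = i" by (auto simp: succ_def split: if_splits)
      then show False using that \<open>rigid j\<close> by simp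
    qed
  qed
  have "rigid i \<longleftrightarrow> (even i \<longleftrightarrow> rigid 0)" if "i < n" for i
    using that alt by (induction i) auto
  then have "\<forall>i<n. odd (i + of_bool (rigid 0)) \<longrightarrow> rigid i" by (cases "rigid 0") simp_all
  then show "\<exists>d. \<forall>i<n. odd (i + d) \<longrightarrow> rigid i" ..
next
  assume "\<exists>d. \<forall>i<n. odd (i + d) \<longrightarrow> rigid i"
  then obtain d where d: "\<And>i. i < n \<Longrightarrow> odd (i + d) \<Longrightarrow> rigid i" by blast
  have ev: "even n" using n by presburger
  have "rigid i \<longleftrightarrow> odd (i + d)" if i: "i < n" for i
  proof
    show "odd (i + d)" if "rigid i"
    proof (rule ccontr)
      assume "\<not> odd (i + d)"
      then have "odd (succ i + d)" using ev i by (auto simp: succ_def)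
      then show False using adjacent_not_both_rigid[OF A_succ[OF i] that] d succ_less[OF i] by blast
    qed
  qed (use d i in blast)
  then have "{i. i < n \<and> rigid i} = (\<lambda>k. 2 * k + (if even d then 1 else 0)) ` {..<n div 2}"
  proof -
    assume b: "\<And>i. i < n \<Longrightarrow> rigid i \<longleftrightarrow> odd (i + d)"
    show ?thesis
    proof (intro equalityI subsetI)
      fix i assume "i \<in> {i. i < n \<and> rigid i}"
      then have "i < n" "odd (i + d)" using b by auto
      then show "i \<in> (\<lambda>k. 2 * k + (if even d then 1 else 0)) ` {..<n div 2}"
        using ev by (intro image_eqI[of _ _ "i div 2"]) (auto elim!: evenE oddE)
    next
      fix i assume "i \<in> (\<lambda>k. 2 * k + (if even d then 1 else 0)) ` {..<n div 2}"
      then obtain k where k: "i = 2 * k + (if even d then 1 else 0)" "k < n div 2" by auto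
      then have "i < n" using ev by (auto elim!: evenE)
      then show "i \<in> {i. i < n \<and> rigid i}" using b k by auto
    qed
  qed
  also have "card \<dots> = n div 2" by (subst card_image) (auto simp: inj_on_def)
  finally show "card {i. i < n \<and> rigid i} = n div 2" .
qed

lemma colouring_iff:
  "(\<exists>f. \<forall>i<n. sees_both f i) \<longleftrightarrow> \<not> (n mod 4 = 2 \<and> card {i. i < n \<and> rigid i} = n div 2)"
proof -
  have two: "(\<exists>f. \<forall>i<n. sees_both f i) \<longleftrightarrow> \<not> (\<exists>d. \<forall>i<n. odd (i + d) \<longrightarrow> rigid i)" if n: "n mod 4 = 2"
  proof
    assume "\<exists>f. \<forall>i<n. sees_both f i"
    then show "\<not> (\<exists>d. \<forall>i<n. odd (i + d) \<longrightarrow> rigid i)" using no_colouring_if_class_rigid[OF n] by blast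
  next
    assume "\<not> (\<exists>d. \<forall>i<n. odd (i + d) \<longrightarrow> rigid i)"
    then have "\<not> (\<forall>i<n. odd (i + 0) \<longrightarrow> rigid i)" "\<not> (\<forall>i<n. odd (i + 1) \<longrightarrow> rigid i)" by blast+
    then obtain x y where "x < n" "even x" "\<not> rigid x" "y < n" "odd y" "\<not> rigid y" by auto
    then show "\<exists>f. \<forall>i<n. sees_both f i" using colouring_mod_2[OF n] by blast
  qed
  consider "n mod 4 = 0" | "n mod 4 = 1" | "n mod 4 = 3" | "n mod 4 = 2" by linarith
  then show ?thesis
  proof cases
    case 1 then show ?thesis using colouring_mod_0 by simp
  next
    case 2 then show ?thesis using colouring_mod_1 by simp
  next
    case 3 then show ?thesis using colouring_mod_3 by simp
  next
    case 4 then show ?thesis using two rigid_class_iff_card by simp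
  qed
qed

end

section \<open>From maximal outerplanar graphs to triangulated polygons\<close>

lemma outerplanar_imp_noncrossing_order:
  assumes "simple_graph V E" "outerplanar V E"
  obtains r :: "'a \<Rightarrow> nat" where "inj_on r V" "noncrossing_order E r"
proof -
  obtain p g where "plane_drawing V E p g" "p ` V \<subseteq> frontier (outside (drawn_set V E p g))"
    using assms(2) unfolding outerplanar_def by blast
  then interpret outer_drawing V E p g using assms(1) by unfold_locales
  have "finite V" using assms(1) unfolding simple_graph_def by blast
  then have "\<exists>r :: 'a \<Rightarrow> nat. inj_on r V \<and> noncrossing_order E r"
    by (rule noncrossing_order_exists[OF _ edge]) (fact no_theta no_crossing_chords | assumption)+
  then show ?thesis using that by blast
qed

text \<open>
A graph together with a numbering of its vertices that turns it into a triangulated polygon.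
\<close>

locale labelled_triangulation =
  fixes V :: "'a set" and E :: "'a set set" and h :: "nat \<Rightarrow> 'a" and n :: nat
  assumes bij: "bij_betw h {..<n} V"
    and edges: "\<And>e. e \<in> E \<Longrightarrow> e \<subseteq> V \<and> card e = 2"
    and triangulation: "polygon_triangulation n (\<lambda>i j. i < n \<and> j < n \<and> {h i, h j} \<in> E)"
begin

definition A :: "nat \<Rightarrow> nat \<Rightarrow> bool" where "A i j \<longleftrightarrow> i < n \<and> j < n \<and> {h i, h j} \<in> E"

sublocale polygon_triangulation n A
  using triangulation unfolding A_def[abs_def] .

lemma h_in: "i < n \<Longrightarrow> h i \<in> V"
  using bij unfolding bij_betw_def by blast

lemma h_eq_iff: "i < n \<Longrightarrow> j < n \<Longrightarrow> h i = h j \<longleftrightarrow> i = j"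
  using bij unfolding bij_betw_def by (auto dest: inj_onD)

lemma vertex_cases: assumes "v \<in> V" obtains i where "i < n" "v = h i"
  using assms bij unfolding bij_betw_def by auto

lemma neighbors_h: "i < n \<Longrightarrow> neighbors E (h i) = h ` {j. A i j}"
proof (intro equalityI subsetI)
  fix u assume i: "i < n" and "u \<in> neighbors E (h i)"
  then have e: "{h i, u} \<in> E" unfolding neighbors_def by simp
  then have "u \<in> V" using edges by blast
  then obtain j where "j < n" "u = h j" by (rule vertex_cases)
  then show "u \<in> h ` {j. A i j}" using e i unfolding A_def by blast
qed (auto simp: A_def neighbors_def)

lemma mem_neighbors_h: "i < n \<Longrightarrow> j < n \<Longrightarrow> h j \<in> neighbors E (h i) \<longleftrightarrow> A i j"
  unfolding A_def neighbors_def by simp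

text \<open>
Membership in the first set serves as the colour; the second set lies in the other colour class.
\<close>

lemma total_domination_iff_colouring:
  "two_disjoint_total_dominating_sets V E \<longleftrightarrow> (\<exists>f. \<forall>i<n. sees_both f i)"
proof
  assume "two_disjoint_total_dominating_sets V E"
  then obtain S T where ST: "total_dominating V E S" "total_dominating V E T" "S \<inter> T = {}"
    unfolding two_disjoint_total_dominating_sets_def by blast
  have "sees_both (\<lambda>i. h i \<in> S) i" if i: "i < n" for i
  proof -
    have "\<exists>j. A i j \<and> h j \<in> X" if X: "total_dominating V E X" for X
    proof -
      obtain u where u: "u \<in> X" "{h i, u} \<in> E" using X h_in[OF i] unfolding total_dominating_def by blast
      then have "u \<in> V" using edges by blast
      then obtain j where "j < n" "u = h j" by (rule vertex_cases)
      then show ?thesis using u i unfolding A_def by blast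
    qed
    then obtain j k where "A i j" "h j \<in> S" "A i k" "h k \<in> T" using ST by blast
    then show ?thesis using ST(3) unfolding sees_both_def by blast
  qed
  then show "\<exists>f. \<forall>i<n. sees_both f i" by blast
next
  assume "\<exists>f. \<forall>i<n. sees_both f i"
  then obtain f where f: "\<And>i. i < n \<Longrightarrow> sees_both f i" by blast
  have dom: "total_dominating V E (h ` {i. i < n \<and> f i = b})" for b
    unfolding total_dominating_def
  proof (intro conjI ballI)
    show "h ` {i. i < n \<and> f i = b} \<subseteq> V" using h_in by auto
    fix v assume "v \<in> V"
    then obtain i where i: "i < n" "v = h i" by (rule vertex_cases)
    obtain j where "A i j" "f j = b" using f[OF i(1)] unfolding sees_both_def by metis
    then show "\<exists>u\<in>h ` {i. i < n \<and> f i = b}. {v, u} \<in> E" using i unfolding A_def by blast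
  qed
  have "h ` {i. i < n \<and> f i = True} \<inter> h ` {i. i < n \<and> f i = False} = {}"
    using h_eq_iff by auto
  then show "two_disjoint_total_dominating_sets V E"
    using dom unfolding two_disjoint_total_dominating_sets_def by blast
qed

lemma degree_h: "i < n \<Longrightarrow> vertex_degree E (h i) = card {j. A i j}"
  unfolding vertex_degree_def neighbors_h
  by (rule card_image) (auto simp: inj_on_def A_def h_eq_iff)

text \<open>
The neighbours are the two adjacent corners, at distance \<open>1\<close> or \<open>n - 1\<close>.
\<close>

lemma degree_2_imp_rigid:
  assumes n: "n mod 4 = 2" and i: "i < n" and deg: "card {j. A i j} = 2"
  shows "rigid i"
proof -
  have ne: "succ i \<noteq> pred i" using i order by (auto simp: succ_def pred_def)
  have "finite {j. A i j}" using deg by (simp add: card_ge_0_finite)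
  moreover have "{succ i, pred i} \<subseteq> {j. A i j}" using A_succ[OF i] A_pred[OF i] by simp
  moreover have "card {succ i, pred i} = card {j. A i j}" using deg ne by simp
  ultimately have eq: "{j. A i j} = {succ i, pred i}" using card_subset_eq by blast
  have "offset i (succ i) = 1" "offset i (pred i) = int n - 1"
    using offset_succ_self[OF i] i order by (auto simp: offset_def pred_def)
  then have "gap i (succ i) = 1" "gap i (pred i) = 1"
    using offset_gap_mod_2[OF n, of i "succ i" 1] offset_gap_mod_2[OF n, of i "pred i" 1] by auto
  moreover have "j = succ i \<or> j = pred i" if "A i j" for j using eq that by blast
  ultimately show ?thesis unfolding rigid_def by metis
qed

text \<open>
Centrality refers to some Hamiltonian cycle starting in the vertex. Its second vertex is a neighbour at
index \<open>1\<close>, so all neighbours have index \<open>1\<close> modulo \<open>4\<close>, and the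
index is the offset or its complement.
\<close>

lemma central_imp_rigid:
  assumes n: "n mod 4 = 2" and i: "i < n" and central: "central V E (h i)"
  shows "rigid i"
proof -
  obtain c where c: "hamiltonian_cycle V E c" "c ! 0 = h i"
    and cong: "\<And>k l. k < length c \<Longrightarrow> l < length c \<Longrightarrow> c ! k \<in> neighbors E (h i) \<Longrightarrow> c ! l \<in> neighbors E (h i) \<Longrightarrow>
      k mod 4 = l mod 4"
    using central unfolding central_def by blast
  note cyc = c(1)[unfolded hamiltonian_cycle_def]
  have card: "card V = n" using bij_betw_same_card[OF bij] by simp
  then have len: "length c = n" using cyc distinct_card[of c] by simp
  define d where "d = (\<lambda>k. inv_into {..<n} h (c ! k))"
  have bij_c: "bij_betw ((!) c) {..<n} V" using bij_betw_nth[of c "{..<n}" V] cyc len by (simp add: lessThan_atLeast0)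
  have "bij_betw (inv_into {..<n} h \<circ> (!) c) {..<n} {..<n}"
    using bij_betw_trans[OF bij_c bij_betw_inv_into[OF bij]] .
  then have bij_d: "bij_betw d {..<n} {..<n}" unfolding d_def comp_def .
  have d: "d k < n \<and> h (d k) = c ! k" if "k < n" for k
  proof
    show "d k < n" using bij_d that unfolding bij_betw_def by blast
    have "c ! k \<in> h ` {..<n}" using bij_c bij that unfolding bij_betw_def by blast
    then show "h (d k) = c ! k" unfolding d_def by (rule f_inv_into_f)
  qed
  have adj: "A (d k) (d (Suc k mod n))" if "k < n" for k
    using that cyc len d[OF that] d[of "Suc k mod n"] unfolding A_def by simp
  have n0: "0 < n" using order by simp
  have d0: "d 0 = i" using d[OF n0] c(2) h_eq_iff i by auto
  have "A i (d 1)" using adj[OF n0] order d0 by simp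
  then have one: "c ! 1 \<in> neighbors E (h i)" "1 < length c"
    using mem_neighbors_h[OF i, of "d 1"] d[of 1] order len by auto
  show ?thesis
    unfolding rigid_def
  proof (intro allI impI)
    fix j assume j: "A i j"
    have "j < n" using range'[OF j] .
    then obtain k where k: "k < n" "j = d k" using bij_d unfolding bij_betw_def by (metis imageE lessThan_iff)
    have "k \<noteq> 0" using k(2) d0 j irrefl[of i] by (metis (full_types))
    have "c ! k \<in> neighbors E (h i)" using mem_neighbors_h[OF i \<open>j < n\<close>] j d[OF k(1)] k(2) by simp
    then have "k mod 4 = 1 mod 4" using cong[of k 1] one k(1) len by simp
    then have "int k mod 4 = 1" by presburger
    moreover have "offset i j = int k \<or> offset i j = int n - int k"
      using hamiltonian_offset[OF bij_d adj, of k] \<open>k \<noteq> 0\<close> k d0 by simp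
    ultimately show "gap i j = 1" using offset_gap_mod_2[OF n] by blast
  qed
qed

text \<open>
The boundary of the polygon serves as the Hamiltonian cycle. A neighbour of degree \<open>2\<close>
would be rigid as well, but adjacent vertices are not both rigid.
\<close>

lemma rigid_imp_central:
  assumes n: "n mod 4 = 2" and i: "i < n" and rigid: "rigid i" and deg: "card {j. A i j} \<noteq> 2"
  shows "central V E (h i)"
proof -
  define c where "c = map (\<lambda>k. h ((i + k) mod n)) [0..<n]"
  have n0: "0 < n" using order by simp
  have len: "length c = n" unfolding c_def by simp
  have nth: "c ! k = h ((i + k) mod n)" if "k < n" for k using that unfolding c_def by simp
  have wrap: "(i + k) mod n = (if i + k < n then i + k else i + k - n)" if "k < n" for k
    using i that by (simp add: mod_if)
  have inj: "inj_on (\<lambda>k. (i + k) mod n) {..<n}"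
    by (rule inj_onI) (auto simp: wrap split: if_splits)
  have "(\<lambda>k. (i + k) mod n) ` {..<n} = {..<n}"
    by (rule card_subset_eq) (use n0 card_image[OF inj] in auto)
  then have set: "set c = V"
    using bij unfolding c_def bij_betw_def
    by (metis (no_types, lifting) image_cong image_image image_set lessThan_atLeast0 set_upt)
  have dist: "distinct c"
    unfolding c_def distinct_map
  proof
    show "inj_on (\<lambda>k. h ((i + k) mod n)) (set [0..<n])"
    proof (rule inj_onI)
      fix k l assume kl: "k \<in> set [0..<n]" "l \<in> set [0..<n]" "h ((i + k) mod n) = h ((i + l) mod n)"
      have "(i + k) mod n = (i + l) mod n" using kl(3) h_eq_iff[of "(i + k) mod n" "(i + l) mod n"] n0 by simp
      then show "k = l" using inj_onD[OF inj, of k l] kl(1,2) by simp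
    qed
  qed simp
  have edge: "{c ! k, c ! (Suc k mod n)} \<in> E" if "k < n" for k
  proof -
    have "(i + Suc k mod n) mod n = succ ((i + k) mod n)"
    proof -
      have "(i + Suc k mod n) mod n = Suc (i + k) mod n" using mod_add_right_eq[of i "Suc k" n] by simp
      also have "\<dots> = Suc ((i + k) mod n) mod n" by (simp only: mod_Suc_eq)
      also have "\<dots> = succ ((i + k) mod n)" using succ_mod[of "(i + k) mod n"] n0 by simp
      finally show ?thesis .
    qed
    moreover have "(i + k) mod n < n" using n0 by simp
    ultimately have "A ((i + k) mod n) ((i + Suc k mod n) mod n)" using A_succ by metis
    moreover have "Suc k mod n < n" using n0 by simp
    ultimately show ?thesis using nth[OF that] nth[of "Suc k mod n"] unfolding A_def by metis
  qed
  have ham: "hamiltonian_cycle V E c"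
    unfolding hamiltonian_cycle_def using dist set len edge order by simp
  have one: "k mod 4 = 1" if k: "k < n" "c ! k \<in> neighbors E (h i)" for k
  proof -
    let ?j = "(i + k) mod n"
    have A: "A i ?j" using mem_neighbors_h[OF i, of ?j] k nth n0 by simp
    have "offset i ?j = int k" using wrap[OF k(1)] k(1) i by (auto simp: offset_def)
    moreover have "gap i ?j = 1" using rigid A unfolding rigid_def by blast
    ultimately have "int k mod 4 = 1" using offset_gap_mod_2[OF n, of i ?j "int k"] by blast
    then show ?thesis by presburger
  qed
  have deg2: "vertex_degree E u \<noteq> 2" if u: "u \<in> insert (h i) (neighbors E (h i))" for u
  proof -
    consider "u = h i" | j where "A i j" "u = h j" using u neighbors_h[OF i] by auto
    then show ?thesis
    proof cases
      case 1 then show ?thesis using degree_h[OF i] deg by simp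
    next
      case 2
      then show ?thesis using degree_h[OF range'[OF 2(1)]] degree_2_imp_rigid[OF n range'[OF 2(1)]]
          adjacent_not_both_rigid[OF 2(1) rigid] by auto
    qed
  qed
  have "c ! 0 = h i" using nth[OF n0] i by simp
  then show ?thesis
    unfolding central_def using h_in[OF i] deg2 ham one len by (metis (no_types, lifting))
qed

lemma degree_2_plus_central_count:
  assumes n: "n mod 4 = 2"
  shows "card {v \<in> V. vertex_degree E v = 2} + card {v \<in> V. central V E v} = card {i. i < n \<and> rigid i}"
proof -
  let ?D = "{v \<in> V. vertex_degree E v = 2}" and ?C = "{v \<in> V. central V E v}"
  have fin: "finite V" using bij bij_betw_finite by blast
  have "?D \<inter> ?C = {}" unfolding central_def by blast
  then have "card ?D + card ?C = card (?D \<union> ?C)" using fin by (simp add: card_Un_disjoint)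
  also have "?D \<union> ?C = h ` {i. i < n \<and> rigid i}"
  proof (intro equalityI subsetI)
    fix v assume v: "v \<in> ?D \<union> ?C"
    then have "v \<in> V" by auto
    then obtain i where i: "i < n" "v = h i" by (rule vertex_cases)
    then show "v \<in> h ` {i. i < n \<and> rigid i}"
      using v degree_h[OF i(1)] degree_2_imp_rigid[OF n i(1)] central_imp_rigid[OF n i(1)] by auto
  next
    fix v assume "v \<in> h ` {i. i < n \<and> rigid i}"
    then obtain i where i: "i < n" "rigid i" "v = h i" by auto
    then show "v \<in> ?D \<union> ?C"
      using rigid_imp_central[OF n i(1,2)] degree_h[OF i(1)] h_in[OF i(1)] by auto
  qed
  also have "card \<dots> = card {i. i < n \<and> rigid i}"
    by (rule card_image) (auto simp: inj_on_def h_eq_iff)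
  finally show ?thesis .
qed

lemma generalized_sun_iff:
  assumes "maximal_outerplanar V E"
  shows "generalized_sun V E \<longleftrightarrow> n mod 4 = 2 \<and> card {i. i < n \<and> rigid i} = n div 2"
proof -
  have card: "card V = n" using bij_betw_same_card[OF bij] by simp
  have "(\<exists>k\<ge>1. n = 4 * k + 2) \<longleftrightarrow> n mod 4 = 2" using order by presburger
  then show ?thesis
    unfolding generalized_sun_def card using assms degree_2_plus_central_count by auto
qed

end

text \<open>
Number the vertices by their rank in a noncrossing order. An absent edge that crosses no edge could be added
without destroying the order, hence without destroying outerplanarity.
\<close>

lemma maximal_outerplanar_labelling:
  assumes max: "maximal_outerplanar V E" and card: "4 \<le> card V"
  obtains h where "labelled_triangulation V E h (card V)"
proof -
  have graph: "simple_graph V E" and outer: "outerplanar V E"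
    and no_more: "\<And>u v. u \<in> V \<Longrightarrow> v \<in> V \<Longrightarrow> u \<noteq> v \<Longrightarrow> {u, v} \<notin> E \<Longrightarrow> \<not> outerplanar V (insert {u, v} E)"
    using max unfolding maximal_outerplanar_def by auto
  have fin: "finite V" and edges: "\<And>e. e \<in> E \<Longrightarrow> e \<subseteq> V \<and> card e = 2"
    using graph unfolding simple_graph_def by auto
  obtain r :: "'a \<Rightarrow> nat" where inj: "inj_on r V" and nc: "noncrossing_order E r"
    using outerplanar_imp_noncrossing_order[OF graph outer] .
  define idx where "idx = (\<lambda>v. card {u \<in> V. r u < r v})"
  have mono: "idx u < idx v" if "u \<in> V" "r u < r v" for u v
    unfolding idx_def by (rule psubset_card_mono) (use fin that in auto)
  have less_iff: "idx u < idx v \<longleftrightarrow> r u < r v" if "u \<in> V" "v \<in> V" for u v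
    using mono[of u v] mono[of v u] that inj by (metis inj_onD less_asym less_irrefl nat_neq_iff)
  have idx_less: "idx v < card V" if "v \<in> V" for v
    unfolding idx_def by (rule psubset_card_mono) (use fin that in auto)
  have inj_idx: "inj_on idx V"
    using less_iff inj by (metis inj_onD inj_onI less_irrefl nat_neq_iff)
  have "idx ` V = {..<card V}"
    by (rule card_subset_eq) (use idx_less card_image[OF inj_idx] in auto)
  then have bij_idx: "bij_betw idx V {..<card V}" using inj_idx unfolding bij_betw_def by blast
  define h where "h = inv_into V idx"
  have bij: "bij_betw h {..<card V} V" unfolding h_def by (rule bij_betw_inv_into[OF bij_idx])
  have h: "h i \<in> V \<and> idx (h i) = i" if "i < card V" for i
    using that bij bij_idx unfolding bij_betw_def h_def by (auto simp: f_inv_into_f)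
  have hidx: "h (idx v) = v" if "v \<in> V" for v
    unfolding h_def using inj_idx that by simp
  have r_less: "r (h i) < r (h j) \<longleftrightarrow> i < j" if "i < card V" "j < card V" for i j
    using less_iff[of "h i" "h j"] h that by simp
  let ?A = "\<lambda>i j. i < card V \<and> j < card V \<and> {h i, h j} \<in> E"
  have "polygon_triangulation (card V) ?A"
  proof (rule polygon_triangulation.intro)
    show "4 \<le> card V" by fact
    show "?A j i" if "?A i j" for i j using that by (simp add: insert_commute)
    show "i < card V" if "?A i j" for i j using that by simp
    show "\<not> ?A i i" for i using edges[of "{h i, h i}"] by auto
    show False if "?A i k" "?A j l" "i < j" "j < k" "k < l" for i j k l
      using noncrossing_orderD[OF nc, of "h i" "h k" "h j" "h l"] that r_less by auto
    show "\<exists>k l. ?A k l \<and> (i < k \<and> k < j \<and> j < l \<or> k < i \<and> i < l \<and> l < j)"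
      if ij: "i < j" "j < card V" "\<not> ?A i j" for i j
    proof (rule ccontr)
      assume none: "\<not> ?thesis"
      let ?e = "{h i, h j}"
      have i: "i < card V" using ij by simp
      have hij: "h i \<in> V" "h j \<in> V" "h i \<noteq> h j" "?e \<notin> E"
        using h[OF i] h[OF ij(2)] ij i by auto
      have "noncrossing_order (insert ?e E) r"
        unfolding noncrossing_order_def
      proof (intro allI impI notI)
        fix a b c d
        assume e: "{a, b} \<in> insert ?e E" "{c, d} \<in> insert ?e E" and o: "r a < r c \<and> r c < r b \<and> r b < r d"
        have rij: "r (h i) < r (h j)" using r_less i ij by simp
        have cross: False
          if uv: "{u, v} \<in> E" "r (h i) < r u \<and> r u < r (h j) \<and> r (h j) < r v \<or> r u < r (h i) \<and> r (h i) < r v \<and> r v < r (h j)" for u v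
        proof -
          have V: "u \<in> V" "v \<in> V" using edges uv(1) by auto
          have "?A (idx u) (idx v)" using V idx_less hidx uv(1) by simp
          moreover have "i < idx u \<and> idx u < j \<and> j < idx v \<or> idx u < i \<and> i < idx v \<and> idx v < j"
            using uv(2) less_iff V hij(1,2) h[OF i] h[OF ij(2)] by metis
          ultimately show False using none by blast
        qed
        consider "{a, b} \<in> E" "{c, d} \<in> E" | "{a, b} = ?e" "{c, d} \<in> E" | "{a, b} \<in> E" "{c, d} = ?e"
          | "{a, b} = ?e" "{c, d} = ?e" using e by blast
        then show False
        proof cases
          case 1 then show False using noncrossing_orderD[OF nc] o by blast
        next
          case 2
          then have "a = h i \<and> b = h j" using o rij by (auto simp: doubleton_eq_iff)
          then show False using cross[OF 2(2)] o by simp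
        next
          case 3
          then have "c = h i \<and> d = h j" using o rij by (auto simp: doubleton_eq_iff)
          then show False using cross[OF 3(1)] o by simp
        next
          case 4
          then show False using o by (auto simp: doubleton_eq_iff)
        qed
      qed
      moreover have "simple_graph V (insert ?e E)"
        using graph hij unfolding simple_graph_def by simp
      ultimately have "outerplanar V (insert ?e E)" using noncrossing_order_imp_outerplanar inj by blast
      then show False using no_more hij by blast
    qed
  qed
  then have "labelled_triangulation V E h (card V)" 
    using bij edges by (simp add: labelled_triangulation_def)
  then show ?thesis using that by blast
qed

theorem theorem2:
  fixes V :: "'a set" and E :: "'a set set"
  assumes "maximal_outerplanar V E"
    and "card V \<ge> 4"
  shows "(generalized_sun V E \<or> two_disjoint_total_dominating_sets V E) \<and>
         \<not> (generalized_sun V E \<and> two_disjoint_total_dominating_sets V E)"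
proof -
  obtain h where "labelled_triangulation V E h (card V)"
    using maximal_outerplanar_labelling[OF assms] .
  then interpret labelled_triangulation V E h "card V" .
  show ?thesis
    using generalized_sun_iff[OF assms(1)] total_domination_iff_colouring colouring_iff by blast
qed

end
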